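(* Let $p\ge q\ge2$ and $n$ be integers with $p+q\le n-1$ and $n\equiv p+q \pmod 2$, and let $G\in\mathcal{G}_{n,p,q}$. Then (i) for $\alpha=0$, $\lambda_\alpha(G)\ge\lambda_\alpha(B^5_{n,p,q})=\lambda_\alpha(B^6_{n,p,q})$, with equality if and only if $G\cong B^5_{n,p,q}$ or $G\cong B^6_{n,p,q}$; (ii) for $0<\alpha<1$, $\lambda_\alpha(G)\ge\lambda_\alpha(B^5_{n,p,q})$, with equality if and only if $G\cong B^5_{n,p,q}$.
   Context: All digraphs are simple. For a digraph $G$, $A(G)$ is its adjacency matrix and $D(G)$ the diagonal matrix of outdegrees; $A_\alpha(G)=\alpha D(G)+(1-\alpha)A(G)$ and $\lambda_\alpha(G)$ is the largest modulus of an eigenvalue of $A_\alpha(G)$. A digraph is bipartite if its vertex set splits into two disjoint sets such that every arc goes between the two sets. $\overleftrightarrow{K_{p,q}}$ is the complete bipartite digraph obtained from $K_{p,q}$ by replacing each edge with a pair of opposite arcs; $\mathcal{G}_{n,p,q}$ is the set of strongly connected bipartite digraphs on $n$ vertices containing $\overleftrightarrow{K_{p,q}}$ as a subdigraph. Let $\overleftrightarrow{K_{p,q}}$ have parts $V_p=\{v_1,\ldots,v_p\}$ and $V_q=\{v_{p+1},\ldots,v_{p+q}\}$, and let $v_{p+q+1},\ldots,v_n$ be new vertices. $B^5_{n,p,q}$ is obtained from $\overleftrightarrow{K_{p,q}}$ by adding the directed path $v_1v_{p+q+1}v_{p+q+2}\cdots v_nv_{p+1}$; $B^6_{n,p,q}$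 is obtained by adding the directed path $v_{p+1}v_{p+q+1}v_{p+q+2}\cdots v_nv_1$. *)

theory Defs
  imports
    "Graph_Theory.Graph_Theory"
    "Jordan_Normal_Form.Spectral_Radius"
    "HOL-Number_Theory.Cong"
begin

text \<open>The rows and columns are indexed by the positions of a list \<open>vs\<close> that enumerates the
  vertices without repetition.\<close>

definition vertex_enum :: "('a, 'b) pre_digraph \<Rightarrow> 'a list \<Rightarrow> bool" where
  "vertex_enum G vs \<longleftrightarrow> distinct vs \<and> set vs = verts G"

definition adj_mat :: "('a, 'b) pre_digraph \<Rightarrow> 'a list \<Rightarrow> real mat" where
  "adj_mat G vs = mat (length vs) (length vs)
     (\<lambda>(i, j). if vs ! i \<rightarrow>\<^bsub>G\<^esub> vs ! j then 1 else 0)"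

definition outdeg_mat :: "('a, 'b) pre_digraph \<Rightarrow> 'a list \<Rightarrow> real mat" where
  "outdeg_mat G vs = mat (length vs) (length vs)
     (\<lambda>(i, j). if i = j then real (out_degree G (vs ! i)) else 0)"

definition A_alpha :: "real \<Rightarrow> ('a, 'b) pre_digraph \<Rightarrow> 'a list \<Rightarrow> real mat" where
  "A_alpha \<alpha> G vs = \<alpha> \<cdot>\<^sub>m outdeg_mat G vs + (1 - \<alpha>) \<cdot>\<^sub>m adj_mat G vs"

text \<open>The choice of the enumeration is irrelevant; see \<open>lambda_alpha_eq\<close> below.\<close>

definition lambda_alpha :: "real \<Rightarrow> ('a, 'b) pre_digraph \<Rightarrow> real" where
  "lambda_alpha \<alpha> G =
     spectral_radius (map_mat complex_of_real (A_alpha \<alpha> G (SOME vs. vertex_enum G vs)))"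

lemma A_alpha_dim [simp]:
  "dim_row (A_alpha \<alpha> G vs) = length vs" "dim_col (A_alpha \<alpha> G vs) = length vs"
  by (simp_all add: A_alpha_def adj_mat_def outdeg_mat_def)

lemma A_alpha_index:
  assumes "distinct vs" "i < length vs" "j < length vs"
  shows "A_alpha \<alpha> G vs $$ (i, j) =
    \<alpha> * (if vs ! i = vs ! j then real (out_degree G (vs ! i)) else 0)
    + (1 - \<alpha>) * (if vs ! i \<rightarrow>\<^bsub>G\<^esub> vs ! j then 1 else 0)"
  using assms by (simp add: A_alpha_def adj_mat_def outdeg_mat_def nth_eq_iff_index_eq)

lemma spectrum_A_alpha_enum_subset:
  assumes vs: "vertex_enum G vs" and ws: "vertex_enum G ws"
  shows "spectrum (map_mat complex_of_real (A_alpha \<alpha> G vs))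
    \<subseteq> spectrum (map_mat complex_of_real (A_alpha \<alpha> G ws))"
proof
  define n where "n = length vs"
  define A where "A = map_mat complex_of_real (A_alpha \<alpha> G vs)"
  define B where "B = map_mat complex_of_real (A_alpha \<alpha> G ws)"
  have d: "distinct vs" "distinct ws" and s: "set ws = set vs"
    using vs ws by (auto simp: vertex_enum_def)
  have len: "length ws = n" using d s by (metis distinct_card n_def)
  have A: "A \<in> carrier_mat n n" and B: "B \<in> carrier_mat n n"
    by (auto simp: A_def B_def len n_def[symmetric])
  have bv: "bij_betw ((!) vs) {0..<n} (set vs)" and bw: "bij_betw ((!) ws) {0..<n} (set vs)"
    using d s len by (auto intro!: bij_betw_nth simp: n_def)
  define f where "f = (\<lambda>i. the_inv_into {0..<n} ((!) vs) (ws ! i))"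
  have bf: "bij_betw f {0..<n} {0..<n}"
    using bij_betw_trans[OF bw bij_betw_the_inv_into[OF bv]] by (simp add: f_def o_def)
  have fn: "f i < n" if "i < n" for i
    using bij_betwE[OF bf] that by auto
  have nth: "vs ! f i = ws ! i" if "i < n" for i
    using that bv bw unfolding f_def
    by (metis atLeastLessThan_iff bij_betwE f_the_inv_into_f_bij_betw zero_le)
  have BA: "B $$ (i, j) = A $$ (f i, f j)" if "i < n" "j < n" for i j
    using that fn len d by (simp add: A_def B_def A_alpha_index nth n_def[symmetric])
  fix k assume "k \<in> spectrum A"
  then obtain v where v: "v \<in> carrier_vec n" "v \<noteq> 0\<^sub>v n" "A *\<^sub>v v = k \<cdot>\<^sub>v v"
    using A by (auto simp: spectrum_def eigenvalue_def eigenvector_def)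
  define w where "w = vec n (\<lambda>i. v $ f i)"
  have "w \<noteq> 0\<^sub>v n"
  proof
    assume w0: "w = 0\<^sub>v n"
    have "v $ i = 0" if "i < n" for i
    proof -
      have "i \<in> f ` {0..<n}" using bf that by (simp add: bij_betw_def)
      then obtain j where j: "j < n" "i = f j" by auto
      have "w $ j = 0" using w0 j by simp
      then show ?thesis using j by (simp add: w_def)
    qed
    then show False using v by auto
  qed
  moreover have "B *\<^sub>v w = k \<cdot>\<^sub>v w"
  proof (rule eq_vecI)
    fix i assume "i < dim_vec (k \<cdot>\<^sub>v w)"
    then have i: "i < n" by (simp add: w_def)
    have "(B *\<^sub>v w) $ i = (\<Sum>j = 0..<n. A $$ (f i, f j) * v $ f j)"
      using i B by (simp add: scalar_prod_def w_def BA)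
    also have "\<dots> = (\<Sum>j = 0..<n. A $$ (f i, j) * v $ j)"
      using sum.reindex_bij_betw[OF bf, of "\<lambda>j. A $$ (f i, j) * v $ j"] .
    also have "\<dots> = (A *\<^sub>v v) $ f i"
      using fn[OF i] A v(1) by (simp add: scalar_prod_def)
    also have "\<dots> = (k \<cdot>\<^sub>v w) $ i"
      using fn[OF i] i v by (simp add: w_def)
    finally show "(B *\<^sub>v w) $ i = (k \<cdot>\<^sub>v w) $ i" .
  qed (use B in \<open>simp add: w_def\<close>)
  ultimately show "k \<in> spectrum B"
    using B by (auto simp: spectrum_def eigenvalue_def eigenvector_def w_def intro!: exI[of _ w])
qed

lemma lambda_alpha_eq:
  assumes "vertex_enum G vs"
  shows "lambda_alpha \<alpha> G = spectral_radius (map_mat complex_of_real (A_alpha \<alpha> G vs))"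
proof -
  have "vertex_enum G (SOME vs. vertex_enum G vs)"
    using assms by (rule someI)
  then show ?thesis
    unfolding lambda_alpha_def spectral_radius_def
    using spectrum_A_alpha_enum_subset assms by (metis subset_antisym)
qed

definition bipartite_digraph :: "('a, 'b) pre_digraph \<Rightarrow> bool" where
  "bipartite_digraph G \<longleftrightarrow>
     (\<exists>U W. U \<inter> W = {} \<and> verts G = U \<union> W \<and> arcs_ends G \<subseteq> U \<times> W \<union> W \<times> U)"

definition bip_class :: "nat \<Rightarrow> nat \<Rightarrow> nat \<Rightarrow> ('a, 'b) pre_digraph set" where
  "bip_class n p q = {G. digraph G \<and> strongly_connected G \<and> bipartite_digraph G
     \<and> card (verts G) = n \<and> (\<exists>H. subgraph H G \<and> complete_bipartite_digraph p q H)}"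

text \<open>In the concrete digraphs the vertex \<open>v\<^sub>i\<close> is the number \<open>i\<close>, counted from 1.\<close>

definition K_bip :: "nat \<Rightarrow> nat \<Rightarrow> nat pair_pre_digraph" where
  "K_bip p q = (let Vp = {1..p}; Vq = {p + 1..p + q} in
     \<lparr>pverts = Vp \<union> Vq, parcs = Vp \<times> Vq \<union> Vq \<times> Vp\<rparr>)"

definition add_dipath :: "'a pair_pre_digraph \<Rightarrow> 'a list \<Rightarrow> 'a pair_pre_digraph" where
  "add_dipath G xs =
     \<lparr>pverts = pverts G \<union> set xs, parcs = parcs G \<union> set (zip xs (tl xs))\<rparr>"

definition B5 :: "nat \<Rightarrow> nat \<Rightarrow> nat \<Rightarrow> (nat, nat \<times> nat) pre_digraph" where
  "B5 n p q = with_proj (add_dipath (K_bip p q) ([1] @ [p + q + 1..<n + 1] @ [p + 1]))"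

definition B6 :: "nat \<Rightarrow> nat \<Rightarrow> nat \<Rightarrow> (nat, nat \<times> nat) pre_digraph" where
  "B6 n p q = with_proj (add_dipath (K_bip p q) ([p + 1] @ [p + q + 1..<n + 1] @ [1]))"

lemma complete_bipartite_K_bip: "complete_bipartite_digraph p q (with_proj (K_bip p q))"
  unfolding complete_bipartite_digraph_pair_def
  by (intro conjI exI[of _ "{1..p}"] exI[of _ "{p + 1..p + q}"]) (auto simp: K_bip_def Let_def)

end

theory Submission
  imports Defs
begin

text \<open>Write \<open>k = n - p - q\<close> and let \<open>c\<close> be the spectral radius of \<open>B\<^sup>5\<close>. A strongly connected digraph
  containing the complete bipartite digraph also contains an ear: a directed path that leaves one
  side, runs through at most \<open>k\<close> new vertices and returns to either side. On the complete bipartite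
  digraph together with such an ear we write down a positive vector \<open>y\<close>, modelled on the Perron
  vector of \<open>B\<^sup>5\<close> and extended by 0, with \<open>c y \<le> A\<^sub>\<alpha> y\<close>; hence \<open>c \<le> \<lambda>\<^sub>\<alpha>(G)\<close>. If \<open>\<lambda>\<^sub>\<alpha>(G) = c\<close>, then by
  strong connectivity \<open>y\<close> is positive on all of \<open>G\<close> and the inequality is an equality, so \<open>G\<close> has no
  vertex or arc outside the ear, which by parity makes it \<open>B\<^sup>5\<close> or \<open>B\<^sup>6\<close>. For \<open>B\<^sup>6\<close> the defect
  at the vertex where the path starts is a positive multiple of \<open>\<alpha> (p - q)\<close>, which excludes it when
  \<open>\<alpha> > 0\<close> and \<open>p > q\<close>; for \<open>p = q\<close> the two digraphs are isomorphic.\<close>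

section \<open>Subinvariant vectors of nonnegative matrices\<close>

text \<open>Dividing an eigenvalue of the scaled matrix by \<open>c\<close> gives an eigenvalue of
  \<open>A\<close>. This allows a matrix to be normalised to spectral radius below 1.\<close>

lemma spectral_radius_smult_le:
  assumes A: "A \<in> carrier_mat n n" and n: "n > 0" and c: "c > 0"
  shows "spectral_radius (complex_of_real c \<cdot>\<^sub>m A) \<le> c * spectral_radius A"
proof -
  have cA: "complex_of_real c \<cdot>\<^sub>m A \<in> carrier_mat n n" using A by simp
  obtain k where k: "k \<in> spectrum (complex_of_real c \<cdot>\<^sub>m A)"
    and sr: "spectral_radius (complex_of_real c \<cdot>\<^sub>m A) = norm k"
    using spectral_radius_mem_max(1)[OF cA n] by auto
  from k obtain v where v: "v \<in> carrier_vec n" "v \<noteq> 0\<^sub>v n"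
    "(complex_of_real c \<cdot>\<^sub>m A) *\<^sub>v v = k \<cdot>\<^sub>v v"
    using A by (auto simp: spectrum_def eigenvalue_def eigenvector_def)
  have "A *\<^sub>v v = (k / complex_of_real c) \<cdot>\<^sub>v v"
  proof (rule eq_vecI)
    fix i assume "i < dim_vec ((k / complex_of_real c) \<cdot>\<^sub>v v)"
    then have i: "i < n" using v by simp
    have "complex_of_real c * (A *\<^sub>v v) $ i = k * v $ i"
      using arg_cong[OF v(3), of "\<lambda>x. x $ i"] i A v(1) by simp
    then show "(A *\<^sub>v v) $ i = ((k / complex_of_real c) \<cdot>\<^sub>v v) $ i"
      using i v(1) c by (simp add: field_simps)
  qed (use A v in auto)
  then have "k / complex_of_real c \<in> spectrum A"
    using A v by (auto simp: spectrum_def eigenvalue_def eigenvector_def)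
  then have "norm (k / complex_of_real c) \<le> spectral_radius A"
    using spectral_radius_mem_max(2)[OF A n] by auto
  then show ?thesis using c by (simp add: sr norm_divide field_simps)
qed

text \<open>One more factor \<open>B\<close> preserves the inequality because the entries of
  \<open>B ^\<^sub>m m\<close> are nonnegative; both facts are therefore carried through a single
  induction.\<close>

lemma nonneg_mat_pow_mult_ge:
  fixes B :: "real mat"
  assumes B: "B \<in> carrier_mat n n" and nonneg: "\<And>i j. i < n \<Longrightarrow> j < n \<Longrightarrow> 0 \<le> B $$ (i, j)"
    and y: "y \<in> carrier_vec n" and c: "0 \<le> c"
    and sub: "\<And>i. i < n \<Longrightarrow> c * y $ i \<le> (B *\<^sub>v y) $ i"
  shows "(\<forall>i<n. \<forall>j<n. 0 \<le> (B ^\<^sub>m m) $$ (i, j)) \<and> (\<forall>i<n. c ^ m * y $ i \<le> (B ^\<^sub>m m *\<^sub>v y) $ i)"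
proof (induction m)
  case 0
  then show ?case using B y by simp
next
  case (Suc m)
  have P: "B ^\<^sub>m m \<in> carrier_mat n n" using B by simp
  have "0 \<le> (B ^\<^sub>m Suc m) $$ (i, j)" if "i < n" "j < n" for i j
    using that P B Suc.IH nonneg by (auto simp: scalar_prod_def intro!: sum_nonneg)
  moreover have "c ^ Suc m * y $ i \<le> (B ^\<^sub>m Suc m *\<^sub>v y) $ i" if i: "i < n" for i
  proof -
    have "c ^ Suc m * y $ i \<le> c * (B ^\<^sub>m m *\<^sub>v y) $ i"
      using Suc.IH i c by (simp add: mult.assoc mult_left_mono)
    also have "\<dots> = (\<Sum>j<n. (B ^\<^sub>m m) $$ (i, j) * (c * y $ j))"
      using i B y by (simp add: scalar_prod_def sum_distrib_left atLeast0LessThan algebra_simps)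
    also have "\<dots> \<le> (\<Sum>j<n. (B ^\<^sub>m m) $$ (i, j) * (B *\<^sub>v y) $ j)"
      using Suc.IH i sub by (intro sum_mono mult_left_mono) auto
    also have "\<dots> = (B ^\<^sub>m m *\<^sub>v (B *\<^sub>v y)) $ i"
      using i P B by (simp add: scalar_prod_def atLeast0LessThan)
    also have "\<dots> = (B ^\<^sub>m Suc m *\<^sub>v y) $ i"
      by (simp add: assoc_mult_mat_vec[OF P B y])
    finally show ?thesis .
  qed
  ultimately show ?case by blast
qed

text \<open>Replaces the Perron-Frobenius theorem by a growth comparison: below spectral radius 1
  the powers of a matrix stay bounded, while a subinvariant vector forces exponential growth at
  \<open>i0\<close>.\<close>

lemma spectral_radius_ge_subinvariant:
  fixes A :: "real mat"
  assumes A: "A \<in> carrier_mat n n" and nonneg: "\<And>i j. i < n \<Longrightarrow> j < n \<Longrightarrow> 0 \<le> A $$ (i, j)"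
    and y: "y \<in> carrier_vec n" and y_nonneg: "\<And>i. i < n \<Longrightarrow> 0 \<le> y $ i"
    and i0: "i0 < n" "0 < y $ i0"
    and sub: "\<And>i. i < n \<Longrightarrow> c * y $ i \<le> (A *\<^sub>v y) $ i"
  shows "c \<le> spectral_radius (map_mat complex_of_real A)"
proof (rule ccontr)
  let ?C = "map_mat complex_of_real A"
  assume "\<not> ?thesis"
  then have lt: "spectral_radius ?C < c" by simp
  have n: "n > 0" using i0 by simp
  have C: "?C \<in> carrier_mat n n" using A by simp
  have "0 \<le> spectral_radius ?C"
    using spectral_radius_mem_max(1)[OF C n] by auto
  \<comment> \<open>Any \<open>d\<close> strictly between the two works: dividing by
    \<open>d\<close> brings the spectral radius below 1 and keeps the growth rate
    \<open>c / d\<close> above 1.\<close>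
  define d where "d = (spectral_radius ?C + c) / 2"
  have d: "spectral_radius ?C < d" "d < c" "0 < d"
    using lt \<open>0 \<le> spectral_radius ?C\<close> by (auto simp: d_def)
  define B where "B = (1 / d) \<cdot>\<^sub>m A"
  have B: "B \<in> carrier_mat n n" using A by (simp add: B_def)
  have mapB: "map_mat complex_of_real B = complex_of_real (1 / d) \<cdot>\<^sub>m ?C"
    using A by (intro eq_matI) (auto simp: B_def)
  have "spectral_radius (map_mat complex_of_real B) \<le> (1 / d) * spectral_radius ?C"
    unfolding mapB using d by (intro spectral_radius_smult_le[OF C n]) simp
  also have "\<dots> < 1" using d by simp
  finally obtain b where b: "\<And>m. norm_bound (map_mat complex_of_real B ^\<^sub>m m) b"
    using spectral_radius_jnf_norm_bound_less_1_upper_triangular[of "map_mat complex_of_real B" n] B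
    by auto
  have entry: "(B ^\<^sub>m m) $$ (i, j) \<le> b" if "i < n" "j < n" for i j m
  proof -
    have "map_mat complex_of_real B ^\<^sub>m m = map_mat complex_of_real (B ^\<^sub>m m)"
      using of_real_hom.mat_hom_pow[OF B, where ?'a = complex] by simp
    then have "norm (complex_of_real ((B ^\<^sub>m m) $$ (i, j))) \<le> b"
      using b[of m] that B by (auto simp: norm_bound_def)
    then show ?thesis by simp
  qed
  have grow: "(c / d) ^ m * y $ i0 \<le> (B ^\<^sub>m m *\<^sub>v y) $ i0" for m
  proof -
    have "c / d * y $ i \<le> (B *\<^sub>v y) $ i" if "i < n" for i
      using sub[OF that] that A y d by (simp add: B_def field_simps)
    moreover have "0 \<le> B $$ (i, j)" if "i < n" "j < n" for i j
      using nonneg that A d by (simp add: B_def)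
    ultimately show ?thesis
      using nonneg_mat_pow_mult_ge[OF B _ y, of "c / d" m] d i0 by auto
  qed
  have bound: "(B ^\<^sub>m m *\<^sub>v y) $ i0 \<le> (\<Sum>j<n. b * y $ j)" for m
  proof -
    have "(B ^\<^sub>m m *\<^sub>v y) $ i0 = (\<Sum>j<n. (B ^\<^sub>m m) $$ (i0, j) * y $ j)"
      using i0 B y by (simp add: scalar_prod_def atLeast0LessThan)
    also have "\<dots> \<le> (\<Sum>j<n. b * y $ j)"
      using entry y_nonneg i0 by (intro sum_mono mult_right_mono) auto
    finally show ?thesis .
  qed
  obtain m where "(\<Sum>j<n. b * y $ j) / y $ i0 < (c / d) ^ m"
    using real_arch_pow[of "c / d"] d by auto
  then have "(\<Sum>j<n. b * y $ j) < (c / d) ^ m * y $ i0"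
    using i0 by (simp add: field_simps)
  then show False using grow[of m] bound[of m] by simp
qed

text \<open>Take an eigenvector \<open>v\<close> for an eigenvalue of largest modulus and an index
  where the ratio of the modulus of \<open>v\<close> to \<open>y\<close> is maximal. The triangle
  inequality in that row bounds the eigenvalue by \<open>c\<close>.\<close>

lemma spectral_radius_le_positive_eigenvector:
  fixes A :: "real mat"
  assumes A: "A \<in> carrier_mat n n" and nonneg: "\<And>i j. i < n \<Longrightarrow> j < n \<Longrightarrow> 0 \<le> A $$ (i, j)"
    and n: "n > 0"
    and y: "y \<in> carrier_vec n" and y_pos: "\<And>i. i < n \<Longrightarrow> 0 < y $ i"
    and eig: "\<And>i. i < n \<Longrightarrow> (A *\<^sub>v y) $ i = c * y $ i"
  shows "spectral_radius (map_mat complex_of_real A) \<le> c"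
proof -
  let ?C = "map_mat complex_of_real A"
  have C: "?C \<in> carrier_mat n n" using A by simp
  obtain k where k: "k \<in> spectrum ?C" and sr: "spectral_radius ?C = norm k"
    using spectral_radius_mem_max(1)[OF C n] by auto
  from k obtain v where v: "v \<in> carrier_vec n" "v \<noteq> 0\<^sub>v n" "?C *\<^sub>v v = k \<cdot>\<^sub>v v"
    using A by (auto simp: spectrum_def eigenvalue_def eigenvector_def)
  define f where "f i = norm (v $ i) / y $ i" for i
  have "Max (f ` {..<n}) \<in> f ` {..<n}" using n by (intro Max_in) auto
  then obtain i where i: "i < n" and "f i = Max (f ` {..<n})" by auto
  then have max: "f j \<le> f i" if "j < n" for j using that by simp
  have f_v: "norm (v $ j) = f j * y $ j" if "j < n" for j
    using y_pos[OF that] by (simp add: f_def)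
  have "f i > 0"
  proof (rule ccontr)
    assume "\<not> f i > 0"
    then have "norm (v $ j) \<le> 0" if "j < n" for j
      using max[OF that] that y_pos[OF that] by (simp add: f_v mult_nonpos_nonneg)
    then have "v = 0\<^sub>v n" using v(1) by (intro eq_vecI) auto
    then show False using v(2) by simp
  qed
  have "norm k * (f i * y $ i) = norm ((?C *\<^sub>v v) $ i)"
    using v(1,3) i by (simp add: norm_mult f_v)
  also have "\<dots> = norm (\<Sum>j<n. complex_of_real (A $$ (i, j)) * v $ j)"
    using i A v(1) by (simp add: scalar_prod_def atLeast0LessThan)
  also have "\<dots> \<le> (\<Sum>j<n. norm (complex_of_real (A $$ (i, j)) * v $ j))"
    by (rule norm_sum)
  also have "\<dots> \<le> (\<Sum>j<n. A $$ (i, j) * (f i * y $ j))"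
  proof (rule sum_mono)
    fix j assume "j \<in> {..<n}"
    then have j: "j < n" by simp
    have "norm (complex_of_real (A $$ (i, j)) * v $ j) = A $$ (i, j) * (f j * y $ j)"
      using nonneg[OF i j] by (simp add: norm_mult f_v[OF j])
    also have "\<dots> \<le> A $$ (i, j) * (f i * y $ j)"
      using nonneg[OF i j] max[OF j] y_pos[OF j] by (intro mult_left_mono mult_right_mono) auto
    finally show "norm (complex_of_real (A $$ (i, j)) * v $ j) \<le> A $$ (i, j) * (f i * y $ j)" .
  qed
  also have "\<dots> = f i * (A *\<^sub>v y) $ i"
    using i A y by (simp add: scalar_prod_def atLeast0LessThan sum_distrib_left algebra_simps)
  also have "\<dots> = c * (f i * y $ i)" by (simp add: eig[OF i])
  finally have "norm k * (f i * y $ i) \<le> c * (f i * y $ i)" .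
  then show ?thesis using \<open>f i > 0\<close> y_pos[OF i] sr by simp
qed

section \<open>Subinvariant vectors of digraphs\<close>

definition out_nbrs :: "('a, 'b) pre_digraph \<Rightarrow> 'a \<Rightarrow> 'a set" where
  "out_nbrs G u = {v. u \<rightarrow>\<^bsub>G\<^esub> v}"

text \<open>The action of \<open>A_alpha\<close> on functions on the vertices, free of any
  enumeration. The diagonal entry is distributed over the out-neighbours, so that each arc
  contributes one term and additional arcs only add terms.\<close>

definition A_alpha_op :: "real \<Rightarrow> ('a, 'b) pre_digraph \<Rightarrow> ('a \<Rightarrow> real) \<Rightarrow> 'a \<Rightarrow> real" where
  "A_alpha_op \<alpha> G y u = (\<Sum>v\<in>out_nbrs G u. \<alpha> * y u + (1 - \<alpha>) * y v)"

lemma (in wf_digraph) out_nbrs_subset: "out_nbrs G u \<subseteq> verts G"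
  by (auto simp: out_nbrs_def adj_in_verts)

lemma (in fin_digraph) finite_out_nbrs [simp]: "finite (out_nbrs G u)"
  using out_nbrs_subset finite_verts by (rule finite_subset)

lemma (in digraph) out_degree_eq_card_out_nbrs: "out_degree G u = card (out_nbrs G u)"
proof -
  have "inj_on (head G) (out_arcs G u)"
    by (rule inj_onI) (auto simp: out_arcs_def arc_to_ends_def intro: no_multi_arcs)
  moreover have "head G ` out_arcs G u = out_nbrs G u"
    by (auto simp: out_arcs_def out_nbrs_def arcs_ends_conv)
  ultimately show ?thesis by (metis out_degree_def card_image)
qed

text \<open>The bridge between the matrix indexed by list positions and the operator on
  functions.\<close>

lemma (in digraph) A_alpha_mult_vec:
  assumes vs: "vertex_enum G vs" and i: "i < length vs"
  shows "(A_alpha \<alpha> G vs *\<^sub>v vec (length vs) (\<lambda>j. y (vs ! j))) $ i = A_alpha_op \<alpha> G y (vs ! i)"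
proof -
  let ?u = "vs ! i"
  let ?f = "\<lambda>v. (\<alpha> * (if ?u = v then real (out_degree G ?u) else 0)
    + (1 - \<alpha>) * (if ?u \<rightarrow> v then 1 else 0)) * y v"
  have d: "distinct vs" and s: "set vs = verts G" using vs by (auto simp: vertex_enum_def)
  have u: "?u \<in> verts G" unfolding s[symmetric] using i by (rule nth_mem)
  have "(A_alpha \<alpha> G vs *\<^sub>v vec (length vs) (\<lambda>j. y (vs ! j))) $ i = (\<Sum>j = 0..<length vs. ?f (vs ! j))"
    using i d by (simp add: scalar_prod_def A_alpha_index)
  also have "\<dots> = sum ?f (verts G)"
    using s d by (intro sum.reindex_bij_betw bij_betw_nth) auto
  also have "\<dots> = (\<Sum>v\<in>verts G. if ?u = v then \<alpha> * real (out_degree G ?u) * y v else 0)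
      + (\<Sum>v\<in>verts G. if v \<in> out_nbrs G ?u then (1 - \<alpha>) * y v else 0)"
    unfolding sum.distrib[symmetric]
    by (intro sum.cong) (auto simp: out_nbrs_def algebra_simps)
  also have "\<dots> = \<alpha> * real (out_degree G ?u) * y ?u + (\<Sum>v\<in>verts G \<inter> out_nbrs G ?u. (1 - \<alpha>) * y v)"
    using u by (simp add: sum.inter_restrict)
  also have "verts G \<inter> out_nbrs G ?u = out_nbrs G ?u"
    using out_nbrs_subset by blast
  also have "\<alpha> * real (out_degree G ?u) * y ?u + (\<Sum>v\<in>out_nbrs G ?u. (1 - \<alpha>) * y v)
      = A_alpha_op \<alpha> G y ?u"
    by (simp add: A_alpha_op_def sum.distrib out_degree_eq_card_out_nbrs)
  finally show ?thesis .
qed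

lemma (in digraph) A_alpha_nonneg:
  assumes "vertex_enum G vs" "0 \<le> \<alpha>" "\<alpha> \<le> 1" "i < length vs" "j < length vs"
  shows "0 \<le> A_alpha \<alpha> G vs $$ (i, j)"
  using assms by (auto simp: vertex_enum_def A_alpha_index)

lemma (in fin_digraph) vertex_enum_exists: "\<exists>vs. vertex_enum G vs"
  using finite_distinct_list[OF finite_verts] by (auto simp: vertex_enum_def)

lemma (in digraph) lambda_alpha_ge_subinvariant:
  assumes \<alpha>: "0 \<le> \<alpha>" "\<alpha> \<le> 1"
    and y_nonneg: "\<And>u. u \<in> verts G \<Longrightarrow> 0 \<le> y u"
    and w: "w \<in> verts G" "0 < y w"
    and sub: "\<And>u. u \<in> verts G \<Longrightarrow> c * y u \<le> A_alpha_op \<alpha> G y u"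
  shows "c \<le> lambda_alpha \<alpha> G"
proof -
  obtain vs where vs: "vertex_enum G vs" using vertex_enum_exists by blast
  then have s: "set vs = verts G" by (simp add: vertex_enum_def)
  obtain i0 where i0: "i0 < length vs" "vs ! i0 = w" using w s by (metis in_set_conv_nth)
  show ?thesis
    unfolding lambda_alpha_eq[OF vs]
  proof (rule spectral_radius_ge_subinvariant[where n = "length vs"
        and y = "vec (length vs) (\<lambda>j. y (vs ! j))" and ?i0.0 = i0])
    fix i assume i: "i < length vs"
    then have "vs ! i \<in> verts G" unfolding s[symmetric] by (rule nth_mem)
    then show "c * vec (length vs) (\<lambda>j. y (vs ! j)) $ i
        \<le> (A_alpha \<alpha> G vs *\<^sub>v vec (length vs) (\<lambda>j. y (vs ! j))) $ i"
      unfolding A_alpha_mult_vec[OF vs i] using i sub by simp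
    show "0 \<le> vec (length vs) (\<lambda>j. y (vs ! j)) $ i"
      using i \<open>vs ! i \<in> verts G\<close> y_nonneg by simp
  qed (use i0 w \<alpha> vs A_alpha_nonneg in auto)
qed

lemma (in digraph) lambda_alpha_eq_positive_eigenvector:
  assumes \<alpha>: "0 \<le> \<alpha>" "\<alpha> \<le> 1" and ne: "verts G \<noteq> {}"
    and y_pos: "\<And>u. u \<in> verts G \<Longrightarrow> 0 < y u"
    and eig: "\<And>u. u \<in> verts G \<Longrightarrow> A_alpha_op \<alpha> G y u = c * y u"
  shows "lambda_alpha \<alpha> G = c"
proof (rule antisym)
  obtain vs where vs: "vertex_enum G vs" using vertex_enum_exists by blast
  then have s: "set vs = verts G" by (simp add: vertex_enum_def)
  show "lambda_alpha \<alpha> G \<le> c"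
    unfolding lambda_alpha_eq[OF vs]
  proof (rule spectral_radius_le_positive_eigenvector[where n = "length vs"
        and y = "vec (length vs) (\<lambda>j. y (vs ! j))"])
    fix i assume i: "i < length vs"
    then have "vs ! i \<in> verts G" unfolding s[symmetric] by (rule nth_mem)
    then show "(A_alpha \<alpha> G vs *\<^sub>v vec (length vs) (\<lambda>j. y (vs ! j))) $ i
        = c * vec (length vs) (\<lambda>j. y (vs ! j)) $ i"
      unfolding A_alpha_mult_vec[OF vs i] using i eig by simp
    show "0 < vec (length vs) (\<lambda>j. y (vs ! j)) $ i"
      using i \<open>vs ! i \<in> verts G\<close> y_pos by simp
  qed (use \<alpha> vs A_alpha_nonneg ne s in auto)
  obtain w where "w \<in> verts G" using ne by blast
  then show "c \<le> lambda_alpha \<alpha> G"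
    using lambda_alpha_ge_subinvariant[OF \<alpha>, of y w c] y_pos eig by (simp add: less_imp_le)
qed

lemma (in fin_digraph) A_alpha_op_nonneg:
  assumes "0 \<le> \<alpha>" "\<alpha> \<le> 1" "\<And>v. v \<in> verts G \<Longrightarrow> 0 \<le> y v" "u \<in> verts G"
  shows "0 \<le> A_alpha_op \<alpha> G y u"
  unfolding A_alpha_op_def using assms out_nbrs_subset
  by (intro sum_nonneg add_nonneg_nonneg mult_nonneg_nonneg) auto

text \<open>Positivity moves backwards along an arc, because the entry at its head has the positive
  weight \<open>1 - \<alpha>\<close>.\<close>

lemma (in fin_digraph) A_alpha_op_pos:
  assumes \<alpha>: "0 \<le> \<alpha>" "\<alpha> < 1" and y: "\<And>v. v \<in> verts G \<Longrightarrow> 0 \<le> y v"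
    and u: "u \<rightarrow> v" "0 < y v"
  shows "0 < A_alpha_op \<alpha> G y u"
  unfolding A_alpha_op_def
proof (rule sum_pos2[where i = v])
  have "u \<in> verts G" using u adj_in_verts by blast
  then show "0 \<le> \<alpha> * y u + (1 - \<alpha>) * y w" if "w \<in> out_nbrs G u" for w
    using y that out_nbrs_subset \<alpha> by (intro add_nonneg_nonneg mult_nonneg_nonneg) auto
  show "0 < \<alpha> * y u + (1 - \<alpha>) * y v"
    using y[OF \<open>u \<in> verts G\<close>] u \<alpha> by (intro add_nonneg_pos) auto
  show "v \<in> out_nbrs G u" using u by (simp add: out_nbrs_def)
qed simp

lemma A_alpha_op_linear:
  "A_alpha_op \<alpha> G (\<lambda>v. r * y v + s * z v) u = r * A_alpha_op \<alpha> G y u + s * A_alpha_op \<alpha> G z u"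
  unfolding A_alpha_op_def sum_distrib_left sum.distrib[symmetric]
  by (intro sum.cong refl) (simp add: algebra_simps)

text \<open>Used in two ways: to find a vertex to which positivity or strictness spreads next, and
  to find an arc leaving the complete bipartite part.\<close>

lemma (in wf_digraph) reachable_crossing_arc:
  assumes "u \<rightarrow>\<^sup>* v" "u \<notin> C" "v \<in> C"
  obtains x z where "x \<in> verts G" "x \<notin> C" "z \<in> C" "x \<rightarrow> z"
proof -
  have "\<exists>x z. x \<in> verts G \<and> x \<notin> C \<and> z \<in> C \<and> x \<rightarrow> z"
    using assms
  proof (induction rule: converse_reachable_induct)
    case (step x y)
    then show ?case using adj_in_verts by blast
  qed auto
  then show ?thesis using that by blast
qed

text \<open>Adding to a subinvariant vector its image spreads the strict inequalities backwards along
  the arcs, so by strong connectivity finitely many such steps make all of them strict.\<close>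

lemma (in digraph) strictly_subinvariant_exists:
  assumes sc: "strongly_connected G" and \<alpha>: "0 \<le> \<alpha>" "\<alpha> < 1"
    and "\<And>u. u \<in> verts G \<Longrightarrow> 0 \<le> y u"
    and "w \<in> verts G" "0 < y w"
    and "\<And>u. u \<in> verts G \<Longrightarrow> c * y u \<le> A_alpha_op \<alpha> G y u"
    and "x \<in> verts G" "c * y x < A_alpha_op \<alpha> G y x"
  shows "\<exists>z. (\<forall>u\<in>verts G. 0 \<le> z u) \<and> 0 < z w \<and> (\<forall>u\<in>verts G. c * z u < A_alpha_op \<alpha> G z u)"
  using assms(4-)
proof (induction "card {u \<in> verts G. A_alpha_op \<alpha> G y u = c * y u}" arbitrary: y x rule: less_induct)
  case less
  define d where "d = (\<lambda>u. A_alpha_op \<alpha> G y u - c * y u)"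
  have d_nonneg: "0 \<le> d u" if "u \<in> verts G" for u
    using less.prems(4)[OF that] by (simp add: d_def)
  show ?case
  proof (cases "\<forall>u\<in>verts G. 0 < d u")
    case True
    then show ?thesis using less.prems by (intro exI[of _ y]) (auto simp: d_def)
  next
    case False
    then obtain u where u: "u \<in> verts G" "\<not> 0 < d u" by blast
    have "u \<rightarrow>\<^sup>* x" using sc u(1) less.prems(5) by blast
    then obtain u' v where u': "u' \<in> verts G" "u' \<notin> {v. 0 < d v}" "v \<in> {v. 0 < d v}" "u' \<rightarrow> v"
      by (rule reachable_crossing_arc[where C = "{v. 0 < d v}"])
        (use u less.prems(6) in \<open>auto simp: d_def\<close>)
    \<comment> \<open>By linearity the defect of \<open>y'\<close> is \<open>d\<close> plus the
      image of \<open>d\<close>. The factors 1 match the form of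
      \<open>A_alpha_op_linear\<close>.\<close>
    define y' where "y' = (\<lambda>u. 1 * y u + 1 * A_alpha_op \<alpha> G y u)"
    have d': "A_alpha_op \<alpha> G y' v - c * y' v = d v + A_alpha_op \<alpha> G d v" for v
    proof -
      have "A_alpha_op \<alpha> G d v = 1 * A_alpha_op \<alpha> G (A_alpha_op \<alpha> G y) v + (- c) * A_alpha_op \<alpha> G y v"
        unfolding A_alpha_op_linear[symmetric] by (simp add: d_def)
      then show ?thesis
        unfolding y'_def A_alpha_op_linear by (simp add: d_def algebra_simps)
    qed
    have op_d: "0 \<le> A_alpha_op \<alpha> G d v" if "v \<in> verts G" for v
      using A_alpha_op_nonneg[of \<alpha> d v] \<alpha> d_nonneg that by simp
    have op_y: "0 \<le> A_alpha_op \<alpha> G y v" if "v \<in> verts G" for v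
      using A_alpha_op_nonneg[of \<alpha> y v] \<alpha> less.prems(1) that by simp
    have d'_u': "0 < A_alpha_op \<alpha> G d u'"
      using A_alpha_op_pos[of \<alpha> d u' v] \<alpha> d_nonneg u' by simp
    \<comment> \<open>Since \<open>d\<close> and its image are nonnegative, the new defect vanishes
      only where \<open>d\<close> does; the vertex \<open>u'\<close>, which has an arc into the
      positive set of \<open>d\<close>, leaves the zero set.\<close>
    have "{v \<in> verts G. A_alpha_op \<alpha> G y' v = c * y' v} \<subset> {v \<in> verts G. A_alpha_op \<alpha> G y v = c * y v}"
    proof
      show "{v \<in> verts G. A_alpha_op \<alpha> G y' v = c * y' v} \<subseteq> {v \<in> verts G. A_alpha_op \<alpha> G y v = c * y v}"
      proof safe
        fix v assume v: "v \<in> verts G" "A_alpha_op \<alpha> G y' v = c * y' v"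
        then show "A_alpha_op \<alpha> G y v = c * y v"
          using d'[of v] op_d[of v] d_nonneg[of v] by (simp add: d_def)
      qed
      have "A_alpha_op \<alpha> G y' u' \<noteq> c * y' u'"
        using d'[of u'] d'_u' d_nonneg[OF u'(1)] by simp
      moreover have "A_alpha_op \<alpha> G y u' = c * y u'"
        using u'(2) d_nonneg[OF u'(1)] by (simp add: d_def)
      ultimately show "{v \<in> verts G. A_alpha_op \<alpha> G y' v = c * y' v} \<noteq> {v \<in> verts G. A_alpha_op \<alpha> G y v = c * y v}"
        using u'(1) by blast
    qed
    then have "card {v \<in> verts G. A_alpha_op \<alpha> G y' v = c * y' v}
        < card {v \<in> verts G. A_alpha_op \<alpha> G y v = c * y v}"
      by (intro psubset_card_mono) auto
    then show ?thesis
    proof (rule less.hyps)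
      show "0 \<le> y' v" if "v \<in> verts G" for v
        using less.prems(1)[OF that] op_y[OF that] by (simp add: y'_def)
      show "w \<in> verts G" by fact
      show "0 < y' w"
        using less.prems(2,3) op_y[of w] by (simp add: y'_def)
      show "c * y' v \<le> A_alpha_op \<alpha> G y' v" if "v \<in> verts G" for v
        using d'[of v] op_d[OF that] d_nonneg[OF that] by simp
      show "u' \<in> verts G" by fact
      show "c * y' u' < A_alpha_op \<alpha> G y' u'"
        using d'[of u'] d'_u' d_nonneg[OF u'(1)] by simp
    qed
  qed
qed

text \<open>A strict inequality anywhere could be made strict everywhere, and then a constant larger
  than the spectral radius would still be subinvariant. A zero of the eigenvector would have an arc
  from some zero to a positive entry, where the operator is positive.\<close>

lemma (in digraph) lambda_alpha_eq_imp_eigenvector: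
  assumes sc: "strongly_connected G" and \<alpha>: "0 \<le> \<alpha>" "\<alpha> < 1"
    and y_nonneg: "\<And>u. u \<in> verts G \<Longrightarrow> 0 \<le> y u"
    and w: "w \<in> verts G" "0 < y w"
    and sub: "\<And>u. u \<in> verts G \<Longrightarrow> lambda_alpha \<alpha> G * y u \<le> A_alpha_op \<alpha> G y u"
    and u: "u \<in> verts G"
  shows "A_alpha_op \<alpha> G y u = lambda_alpha \<alpha> G * y u" and "0 < y u"
proof -
  let ?c = "lambda_alpha \<alpha> G"
  have eig: "A_alpha_op \<alpha> G y x = ?c * y x" if x: "x \<in> verts G" for x
  proof (rule ccontr)
    assume "\<not> ?thesis"
    then have "?c * y x < A_alpha_op \<alpha> G y x" using sub[OF x] by simp
    then obtain z where z: "\<And>u. u \<in> verts G \<Longrightarrow> 0 \<le> z u" "0 < z w"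
      "\<And>u. u \<in> verts G \<Longrightarrow> ?c * z u < A_alpha_op \<alpha> G z u"
      using strictly_subinvariant_exists[OF sc \<alpha> y_nonneg w sub x] by blast
    \<comment> \<open>The slack relative to \<open>z\<close>; the added 1 keeps the denominator
      positive where \<open>z\<close> vanishes.\<close>
    define f where "f u = (A_alpha_op \<alpha> G z u - ?c * z u) / (z u + 1)" for u
    define e where "e = Min (f ` verts G)"
    have f_pos: "0 < f u" if "u \<in> verts G" for u
      using z(1,3)[OF that] by (simp add: f_def)
    have "e \<in> f ` verts G" unfolding e_def using w(1) by (intro Min_in) auto
    then have e: "0 < e" using f_pos by auto
    have "(?c + e) * z u \<le> A_alpha_op \<alpha> G z u" if "u \<in> verts G" for u
    proof -
      have "e \<le> f u" unfolding e_def using that by simp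
      then have "e * (z u + 1) \<le> A_alpha_op \<alpha> G z u - ?c * z u"
        using z(1)[OF that] by (simp add: f_def field_simps)
      moreover have "e * z u \<le> e * (z u + 1)" using e by simp
      ultimately show ?thesis by (simp add: algebra_simps)
    qed
    then have "?c + e \<le> ?c"
      using lambda_alpha_ge_subinvariant[of \<alpha> z w "?c + e"] \<alpha> z(1,2) w(1) by simp
    then show False using e by simp
  qed
  show "A_alpha_op \<alpha> G y u = ?c * y u" by (rule eig[OF u])
  show "0 < y u"
  proof (rule ccontr)
    assume "\<not> 0 < y u"
    have "u \<rightarrow>\<^sup>* w" using sc u w by blast
    then obtain x v where x: "x \<in> verts G" "x \<notin> {v. 0 < y v}" "v \<in> {v. 0 < y v}" "x \<rightarrow> v"
      by (rule reachable_crossing_arc[where C = "{v. 0 < y v}"])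
        (use w \<open>\<not> 0 < y u\<close> in auto)
    then have "y x = 0" using y_nonneg[OF x(1)] by simp
    then have "A_alpha_op \<alpha> G y x = 0" using eig[OF x(1)] by simp
    then show False using A_alpha_op_pos[of \<alpha> y x v] \<alpha> y_nonneg x by simp
  qed
qed

section \<open>Invariance of the spectral radius under isomorphism\<close>

text \<open>Enumerating the vertices of \<open>H\<close> as the images of an enumeration of
  \<open>G\<close> yields the very same matrix.\<close>

lemma (in wf_digraph) lambda_alpha_iso:
  assumes fin: "finite (verts G)" and iso: "digraph_iso G H"
  shows "lambda_alpha \<alpha> G = lambda_alpha \<alpha> H"
proof -
  obtain f where f: "digraph_isomorphism f" and H: "H = app_iso f G"
    using iso by (auto simp: digraph_iso_def)
  obtain vs where vs: "vertex_enum G vs"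
    using finite_distinct_list[OF fin] by (auto simp: vertex_enum_def)
  have inj: "inj_on (iso_verts f) (verts G)" using f by (simp add: digraph_isomorphism_def)
  have s: "set vs = verts G" and d: "distinct vs" using vs by (auto simp: vertex_enum_def)
  have vs': "vertex_enum H (map (iso_verts f) vs)"
    using inj d s by (simp add: vertex_enum_def H distinct_map)
  have dom: "iso_verts f u \<rightarrow>\<^bsub>H\<^esub> iso_verts f v \<longleftrightarrow> u \<rightarrow> v" if "u \<in> verts G" "v \<in> verts G" for u v
  proof
    assume "iso_verts f u \<rightarrow>\<^bsub>H\<^esub> iso_verts f v"
    then obtain u' v' where *: "u' \<rightarrow> v'" "iso_verts f u = iso_verts f u'" "iso_verts f v = iso_verts f v'"
      unfolding H arcs_ends_app_iso_eq[OF f] by auto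
    then have "u = u'" "v = v'"
      using inj_onD[OF inj] that adj_in_verts[OF *(1)] by blast+
    then show "u \<rightarrow> v" using * by simp
  next
    assume "u \<rightarrow> v"
    then show "iso_verts f u \<rightarrow>\<^bsub>H\<^esub> iso_verts f v"
      unfolding H arcs_ends_app_iso_eq[OF f] by (rule rev_image_eqI) simp
  qed
  have "A_alpha \<alpha> H (map (iso_verts f) vs) = A_alpha \<alpha> G vs"
  proof (rule eq_matI)
    fix i j assume "i < dim_row (A_alpha \<alpha> G vs)" "j < dim_col (A_alpha \<alpha> G vs)"
    then have ij: "i < length vs" "j < length vs" by auto
    then have v: "vs ! i \<in> verts G" "vs ! j \<in> verts G" unfolding s[symmetric] by simp_all
    have "distinct (map (iso_verts f) vs)" using vs' by (simp add: vertex_enum_def)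
    then show "A_alpha \<alpha> H (map (iso_verts f) vs) $$ (i, j) = A_alpha \<alpha> G vs $$ (i, j)"
      using ij v d dom f by (simp add: A_alpha_index H out_degree_app_iso_eq)
  qed auto
  then show ?thesis
    using lambda_alpha_eq[OF vs] lambda_alpha_eq[OF vs'] by simp
qed

section \<open>The test vector of an ear\<close>

text \<open>Eliminating the eigenvector from the eigenvalue equations of \<open>B\<^sup>5\<close> leaves the last two equations:
  \<open>t\<close> is the ratio of consecutive entries along the path, and \<open>F\<close> measures the excess of \<open>c\<close> over the
  spectral radius of the complete bipartite digraph, where \<open>F = 0\<close>.\<close>

lemma ear_equation_solvable:
  fixes \<alpha> :: real and p q k :: nat
  assumes \<alpha>: "0 \<le> \<alpha>" "\<alpha> < 1" and q2: "2 \<le> q" and qp: "q \<le> p"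
  obtains c F t where "t = (1 - \<alpha>) / (c - \<alpha>)" "0 < t" "t < 1"
    "\<alpha> < c" "\<alpha> * real p < c" "\<alpha> * real q < c" "0 < F"
    "(c - \<alpha> * real p) * (c - \<alpha> * real q) = (1 - \<alpha>)\<^sup>2 * (real p * real q + F)"
    "F * (c - \<alpha> * real q - \<alpha>) = \<alpha> * real q + t ^ k * (c - \<alpha> * real q)"
proof -
  define b where "b = 1 - \<alpha>"
  define P where "P = real p"
  define Q where "Q = real q"
  have b: "0 < b" "b \<le> 1" "\<alpha> = 1 - b" and Q: "2 \<le> Q" and QP: "Q \<le> P"
    using assms by (auto simp: b_def P_def Q_def)
  have aQ: "\<alpha> * Q < Q" using \<alpha> Q by simp
  \<comment> \<open>\<open>f c\<close> is the value of \<open>F\<close> that the quadratic equation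
    forces, and \<open>g c = 0\<close> is then the remaining equation, to be solved by the
    intermediate value theorem.\<close>
  define f where "f x = (x - \<alpha> * P) * (x - \<alpha> * Q) / b\<^sup>2 - P * Q" for x
  define g where "g x = f x * (x - \<alpha> * Q - \<alpha>) - \<alpha> * Q - (b / (x - \<alpha>)) ^ k * (x - \<alpha> * Q)" for x
  \<comment> \<open>Beyond \<open>x1\<close> all required sign conditions hold: exceeding
    \<open>Q \<ge> 2\<close> gives \<open>t < 1\<close>, and the other two bounds make the linear
    factors positive.\<close>
  define x1 where "x1 = max Q (max (\<alpha> * P) (\<alpha> * Q + \<alpha>))"
  define x2 where "x2 = P + Q + 1"
  have x1: "Q \<le> x1" "\<alpha> * P \<le> x1" "\<alpha> * Q + \<alpha> \<le> x1"
    and x1_cases: "x1 = Q \<or> x1 = \<alpha> * P \<or> x1 = \<alpha> * Q + \<alpha>"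
    by (auto simp: x1_def max_def)
  have "\<alpha> * P \<le> P" using \<alpha> Q QP by (intro mult_left_le_one_le) auto
  then have x12: "x1 \<le> x2"
    using \<alpha>(2) Q QP aQ unfolding x1_def x2_def by (intro max.boundedI) linarith+
  have cont: "continuous_on {x1..x2} g"
    unfolding g_def f_def using x1 Q \<alpha> b by (intro continuous_intros) auto
  \<comment> \<open>Whichever term attains the maximum, either \<open>f x1\<close> is nonpositive or
    the second factor vanishes; the subtracted power term then makes \<open>g x1\<close>
    negative.\<close>
  have "f x1 * (x1 - \<alpha> * Q - \<alpha>) \<le> 0"
  proof -
    have "f x1 \<le> 0 \<or> x1 - \<alpha> * Q - \<alpha> = 0"
    proof -
      consider "x1 = Q" | "x1 = \<alpha> * P" | "x1 = \<alpha> * Q + \<alpha>" using x1_cases by blast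
      then show ?thesis
      proof cases
        case 1
        have "(Q - \<alpha> * P) * (Q - \<alpha> * Q) = (Q - P) * (b * Q) + b\<^sup>2 * (P * Q)"
          by (simp add: b(3) algebra_simps power2_eq_square)
        also have "\<dots> \<le> b\<^sup>2 * (P * Q)"
          using QP b Q by (simp add: mult_nonpos_nonneg)
        finally have "f x1 \<le> 0"
          using b unfolding f_def 1 by (simp add: divide_le_eq mult.commute)
        then show ?thesis by simp
      next
        case 2
        then have "f x1 = - (P * Q)" by (simp add: f_def)
        then show ?thesis using Q QP by simp
      qed simp
    qed
    then show ?thesis using x1 by (auto intro: mult_nonpos_nonneg)
  qed
  moreover have "0 < (b / (x1 - \<alpha>)) ^ k * (x1 - \<alpha> * Q)"
    using b(1) x1(1) Q aQ \<alpha> by (intro mult_pos_pos zero_less_power divide_pos_pos) linarith+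
  moreover have "0 \<le> \<alpha> * Q" using \<alpha> Q by simp
  ultimately have g1: "g x1 < 0" unfolding g_def by linarith
  \<comment> \<open>At the crude upper end, \<open>f x2 \<ge> Q + 2\<close> and
    \<open>D \<ge> 1\<close> give a product of at least \<open>Q + 1 + D\<close>. The subtracted
    terms are at most \<open>\<alpha> * Q + D + \<alpha>\<close>.\<close>
  have g2: "0 \<le> g x2"
  proof -
    define D where "D = x2 - \<alpha> * Q - \<alpha>"
    have D: "1 \<le> D" using aQ \<alpha> Q QP unfolding D_def x2_def by linarith
    have t: "(b / (x2 - \<alpha>)) ^ k \<le> 1"
      using b Q QP by (intro power_le_one) (auto simp: x2_def divide_simps)
    have e: "(x2 - \<alpha> * P) * (x2 - \<alpha> * Q) - b\<^sup>2 * (P * Q)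
        = (Q + 1) * (P + 1) + (b * P) * (P + 1) + (b * Q) * (Q + 1)"
      by (simp add: b(3) x2_def algebra_simps power2_eq_square)
    have "Q + 2 \<le> (Q + 1) * (P + 1)"
      using Q QP mult_mono[of 1 Q 1 P] by (simp add: algebra_simps)
    then have ge: "Q + 2 \<le> (x2 - \<alpha> * P) * (x2 - \<alpha> * Q) - b\<^sup>2 * (P * Q)"
      unfolding e using b Q QP by (intro add_increasing2) auto
    also have "\<dots> \<le> ((x2 - \<alpha> * P) * (x2 - \<alpha> * Q) - b\<^sup>2 * (P * Q)) / b\<^sup>2"
      using ge Q b by (simp add: le_divide_eq mult_left_le power_le_one)
    also have "\<dots> = f x2"
      using b by (simp add: f_def diff_divide_distrib)
    finally have "(Q + 2) * D \<le> f x2 * D" using D by (intro mult_right_mono) auto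
    moreover have "(Q + 1) * 1 \<le> (Q + 1) * D" using D Q by (intro mult_left_mono) auto
    ultimately have fD: "Q + 1 + D \<le> f x2 * D" by (simp add: algebra_simps)
    define T where "T = (b / (x2 - \<alpha>)) ^ k * (x2 - \<alpha> * Q)"
    have "T \<le> 1 * (x2 - \<alpha> * Q)"
      unfolding T_def using t D \<alpha> unfolding D_def by (intro mult_right_mono) linarith+
    then have "T \<le> D + \<alpha>" by (simp add: D_def)
    then show ?thesis
      using aQ \<alpha> fD unfolding g_def D_def[symmetric] T_def[symmetric] by linarith
  qed
  obtain c where c: "x1 \<le> c" "g c = 0"
    using IVT'[of g x1 0 x2, OF less_imp_le[OF g1] g2 x12 cont] by auto
  have "c \<noteq> x1" using g1 c by auto
  then have xc: "x1 < c" using c by simp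
  have eq: "f c * (c - \<alpha> * Q - \<alpha>) = \<alpha> * Q + (b / (c - \<alpha>)) ^ k * (c - \<alpha> * Q)"
    using c(2) by (simp add: g_def)
  have t: "0 < b / (c - \<alpha>)" "b / (c - \<alpha>) < 1"
    using b Q x1 xc by auto
  have "0 < f c * (c - \<alpha> * Q - \<alpha>)"
    unfolding eq using t(1) xc x1(1) \<open>0 \<le> \<alpha> * Q\<close> aQ
    by (intro add_nonneg_pos mult_pos_pos zero_less_power) linarith+
  then have F: "0 < f c"
    using xc x1 by (simp add: zero_less_mult_iff)
  show ?thesis
  proof (rule that[of "b / (c - \<alpha>)" c "f c"])
    show "(c - \<alpha> * real p) * (c - \<alpha> * real q) = (1 - \<alpha>)\<^sup>2 * (real p * real q + f c)"
      using b(1) unfolding b_def[symmetric] P_def[symmetric] Q_def[symmetric]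
      by (simp add: f_def)
    show "\<alpha> < c" using xc x1(1) Q \<alpha> by linarith
    show "\<alpha> * real p < c" "\<alpha> * real q < c"
      using xc x1 aQ unfolding P_def Q_def by linarith+
  qed (use eq t F in \<open>simp_all add: Q_def b_def\<close>)
qed

section \<open>Simple directed paths into a set\<close>

text \<open>The path is built backwards along a walk: it is started afresh when the next vertex is
  already in \<open>C\<close>, and cut at the earlier occurrence when the new first vertex already
  lies on it.\<close>

lemma (in wf_digraph) reachable_path_into:
  assumes "x \<rightarrow>\<^sup>* z" "x \<notin> C" "z \<in> C"
  shows "\<exists>ws u1. ws \<noteq> [] \<and> hd ws = x \<and> distinct ws \<and> set ws \<subseteq> verts G - C \<and> u1 \<in> C
    \<and> successively (dominates G) (ws @ [u1])"
  using assms
proof (induction rule: converse_reachable_induct)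
  case (step x y)
  have x: "x \<in> verts G" using step.hyps(1) adj_in_verts by blast
  show ?case
  proof (cases "y \<in> C")
    case True
    then show ?thesis using step x by (intro exI[of _ "[x]"] exI[of _ y]) auto
  next
    case False
    then obtain ws u1 where ws: "ws \<noteq> []" "hd ws = y" "distinct ws" "set ws \<subseteq> verts G - C"
      "u1 \<in> C" "successively (dominates G) (ws @ [u1])"
      using step.IH step.prems(2) by blast
    show ?thesis
    proof (cases "x \<in> set ws")
      case True
      then obtain as bs where "ws = as @ x # bs" by (meson split_list)
      then show ?thesis
        using ws by (intro exI[of _ "x # bs"] exI[of _ u1]) (auto simp: successively_append_iff)
    next
      case False
      then show ?thesis
        using ws x step.hyps(1) step.prems
        by (intro exI[of _ "x # ws"] exI[of _ u1]) (auto simp: successively_Cons)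
    qed
  qed
qed auto

text \<open>Relates the description of a path by \<open>successively\<close> to its set of arcs as
  formed in \<open>add_dipath\<close>.\<close>

lemma successively_conv_zip_tl: "successively P xs \<longleftrightarrow> (\<forall>(x, y)\<in>set (zip xs (tl xs)). P x y)"
  by (induction P xs rule: successively.induct) auto

text \<open>The two sides of a complete bipartite digraph together with an ear: a directed path that
  leaves the side \<open>R\<close> at \<open>u0\<close>, runs through the new vertices \<open>ws\<close> and returns at \<open>u1\<close>.\<close>

locale bip_ear =
  fixes R S :: "'a set" and u0 :: 'a and ws :: "'a list" and u1 :: 'a
  assumes finite_R [simp]: "finite R" and finite_S [simp]: "finite S"
    and disj: "R \<inter> S = {}"
    and u0: "u0 \<in> R" and u1: "u1 \<in> R \<union> S"
    and ws_ne: "ws \<noteq> []" and ws_distinct: "distinct ws" and ws_new: "set ws \<inter> (R \<union> S) = {}"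
begin

text \<open>The path is a list zipped with its tail, so that the arc sets of \<open>B5\<close> and
  \<open>B6\<close> have this form on unfolding.\<close>

definition ear_arcs :: "('a \<times> 'a) set" where
  "ear_arcs = R \<times> S \<union> S \<times> R \<union> set (zip (u0 # ws @ [u1]) (ws @ [u1]))"

definition succs :: "'a \<Rightarrow> 'a set" where
  "succs v = {w. (v, w) \<in> ear_arcs}"

text \<open>Indexing the arcs by position lets the successor of every path vertex be read off, with
  \<open>u1\<close> following the last one.\<close>

lemma path_arcs:
  "set (zip (u0 # ws @ [u1]) (ws @ [u1]))
    = insert (u0, ws ! 0) {(ws ! i, (ws @ [u1]) ! Suc i) | i. i < length ws}"
proof -
  have "set (zip (u0 # ws @ [u1]) (ws @ [u1]))
      = (\<lambda>i. ((u0 # ws @ [u1]) ! i, (ws @ [u1]) ! i)) ` {..length ws}"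
    unfolding set_zip by (auto simp: less_Suc_eq_le)
  also have "{..length ws} = insert 0 (Suc ` {..<length ws})"
    by (simp add: lessThan_Suc_atMost[symmetric] lessThan_Suc_eq_insert_0)
  finally show ?thesis
    using ws_ne by (auto simp: nth_append image_image)
qed

lemma ws_notin: "i < length ws \<Longrightarrow> ws ! i \<notin> R \<and> ws ! i \<notin> S"
  using ws_new nth_mem by blast

lemma ws_index: "i < length ws \<Longrightarrow> j < length ws \<Longrightarrow> ws ! i = ws ! j \<longleftrightarrow> i = j"
  using ws_distinct by (simp add: nth_eq_iff_index_eq)

lemma succs_S: "v \<in> S \<Longrightarrow> succs v = R"
  using disj u0 ws_notin by (auto simp: succs_def ear_arcs_def path_arcs)

lemma succs_R: "v \<in> R \<Longrightarrow> v \<noteq> u0 \<Longrightarrow> succs v = S"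
  using disj ws_notin by (auto simp: succs_def ear_arcs_def path_arcs)

lemma succs_u0: "succs u0 = insert (ws ! 0) S"
  using disj u0 ws_notin by (auto simp: succs_def ear_arcs_def path_arcs)

lemma succs_ws: "i < length ws \<Longrightarrow> succs (ws ! i) = {(ws @ [u1]) ! Suc i}"
  using disj u0 ws_notin ws_index by (auto simp: succs_def ear_arcs_def path_arcs)

lemma vertex_cases:
  assumes "v \<in> R \<union> S \<union> set ws"
  obtains (right) "v \<in> S" | (left) "v \<in> R" "v \<noteq> u0" | (start) "v = u0"
    | (path) i where "i < length ws" "v = ws ! i"
  using assms by (auto simp: in_set_conv_nth)

lemma card_vertices: "card (R \<union> S \<union> set ws) = card R + card S + length ws"
  using disj ws_new ws_distinct
  by (subst card_Un_disjoint) (auto simp: card_Un_disjoint distinct_card)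

lemma card_R_pos: "0 < card R"
  using u0 by (auto simp: card_gt_0_iff)

end

text \<open>The constants are those of \<open>ear_equation_solvable\<close>. \<open>F_le\<close> is
  an inequality so that it covers both assignments of the sizes \<open>p\<close> and
  \<open>q\<close> to the sides. An ear returning to its own side must be strictly shorter than
  \<open>k\<close>.\<close>

locale ear_vector = bip_ear R S u0 ws u1
  for R S :: "'a set" and u0 :: 'a and ws :: "'a list" and u1 :: 'a +
  fixes \<alpha> c F t :: real and k :: nat
  assumes alpha: "0 \<le> \<alpha>" "\<alpha> < 1"
    and t_def: "t = (1 - \<alpha>) / (c - \<alpha>)" and t: "0 < t" "t < 1"
    and c: "\<alpha> < c" "\<alpha> * real (card R) < c" "\<alpha> * real (card S) < c"
    and F: "0 < F"
    and F_eq: "(c - \<alpha> * real (card R)) * (c - \<alpha> * real (card S))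
      = (1 - \<alpha>)\<^sup>2 * (real (card R) * real (card S) + F)"
    and F_le: "F * (c - \<alpha> * real (card S) - \<alpha>) \<le> \<alpha> * real (card S) + t ^ k * (c - \<alpha> * real (card S))"
    and card_S_pos: "0 < card S"
    and length_ws: "length ws \<le> k" "u1 \<in> R \<Longrightarrow> length ws < k"
begin

text \<open>The path entries are \<open>t ^ (k - i)\<close> whatever the length of \<open>ws\<close>: an ear with fewer than \<open>k\<close> vertices
  then only gains at its last vertex.\<close>

definition base :: real where
  "base = (1 - \<alpha>) * real (card S) / (c - \<alpha> * real (card S))"

text \<open>With entry 1 on \<open>S\<close>, \<open>base\<close> solves the row equation of the
  vertices of \<open>R\<close> other than \<open>u0\<close>, and \<open>peak\<close> is the value at
  \<open>u0\<close> that the rows of \<open>S\<close> then force.\<close>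

definition peak :: real where
  "peak = (1 - \<alpha>) * (real (card S) + F) / (c - \<alpha> * real (card S))"

text \<open>The special vertex \<open>u0\<close> must be tested before membership in
  \<open>R\<close>. The default 0 extends the vector to every digraph containing the ear.\<close>

definition vec_val :: "'a \<Rightarrow> real" where
  "vec_val v = (if v \<in> S then 1 else if v = u0 then peak else if v \<in> R then base
     else if v \<in> set ws then t ^ (k - (THE i. i < length ws \<and> ws ! i = v)) else 0)"

lemma vec_val_S: "v \<in> S \<Longrightarrow> vec_val v = 1"
  by (simp add: vec_val_def)

lemma vec_val_R: "v \<in> R \<Longrightarrow> v \<noteq> u0 \<Longrightarrow> vec_val v = base"
  using disj by (auto simp: vec_val_def)

lemma vec_val_u0: "vec_val u0 = peak"
  using disj u0 by (auto simp: vec_val_def)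

lemma vec_val_ws: "i < length ws \<Longrightarrow> vec_val (ws ! i) = t ^ (k - i)"
proof -
  assume i: "i < length ws"
  then have "(THE j. j < length ws \<and> ws ! j = ws ! i) = i"
    using ws_index by (intro the_equality) auto
  moreover have "ws ! i \<noteq> u0" using ws_notin[OF i] u0 by auto
  ultimately show ?thesis using ws_notin[OF i] i by (simp add: vec_val_def)
qed

lemma base_pos: "0 < base"
  using alpha c card_S_pos by (simp add: base_def)

lemma base_less_peak: "base < peak"
  using alpha c F by (simp add: base_def peak_def divide_strict_right_mono)

text \<open>\<open>t\<close> is the formula of \<open>base\<close> with 1 in place of
  \<open>card S\<close>, and that formula increases with \<open>card S\<close>.\<close>

lemma t_le_base: "t \<le> base"
proof -
  have "1 * c \<le> real (card S) * c" using c alpha card_S_pos by (intro mult_right_mono) auto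
  then have "(1 - \<alpha>) * (c - \<alpha> * real (card S)) \<le> (1 - \<alpha>) * (real (card S) * (c - \<alpha>))"
    using alpha by (intro mult_left_mono) (auto simp: algebra_simps)
  then show ?thesis
    unfolding t_def base_def using c by (simp add: divide_simps algebra_simps)
qed

lemma vec_val_pos_iff: "0 < vec_val v \<longleftrightarrow> v \<in> R \<union> S \<union> set ws"
  using base_pos base_less_peak t u0 by (auto simp: vec_val_def)

lemma vec_val_nonneg: "0 \<le> vec_val v"
  using base_pos base_less_peak t by (auto simp: vec_val_def)

text \<open>The left side is the value at which the last path row is an equality. A return to
  \<open>S\<close> meets the entry 1; a return to \<open>R\<close> meets at least
  \<open>base \<ge> t\<close>, which suffices because the exponent is then at least 1.\<close>

lemma u1_le_vec_val: "t ^ (k - length ws) \<le> vec_val u1"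
proof (cases "u1 \<in> S")
  case True
  then show ?thesis using t by (simp add: vec_val_S power_le_one)
next
  case False
  then have R: "u1 \<in> R" using u1 by blast
  have "t ^ (k - length ws) \<le> t ^ 1"
    using length_ws(2)[OF R] t by (intro power_decreasing) auto
  also have "\<dots> \<le> vec_val u1"
    using R t_le_base base_less_peak vec_val_R vec_val_u0 by (cases "u1 = u0") auto
  finally show ?thesis .
qed

text \<open>The operator restricted to the arcs of the ear.\<close>

definition row :: "'a \<Rightarrow> real" where
  "row v = (\<Sum>w\<in>succs v. \<alpha> * vec_val v + (1 - \<alpha>) * vec_val w)"

lemma sum_vec_val_R: "sum vec_val R = peak + (real (card R) - 1) * base"
proof -
  have "sum vec_val R = vec_val u0 + sum vec_val (R - {u0})"
    using u0 by (simp add: sum.remove)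
  also have "sum vec_val (R - {u0}) = (\<Sum>v\<in>R - {u0}. base)"
    by (intro sum.cong) (auto simp: vec_val_R)
  also have "\<dots> = (real (card R) - 1) * base"
    using u0 card_R_pos by (simp add: card_Diff_singleton of_nat_diff)
  finally show ?thesis by (simp add: vec_val_u0)
qed

text \<open>After inserting the sum of the entries over \<open>R\<close>, this is the equation
  \<open>F_eq\<close>.\<close>

lemma row_S: "v \<in> S \<Longrightarrow> row v = c * vec_val v"
proof -
  assume v: "v \<in> S"
  define L where "L = c - \<alpha> * real (card S)"
  have L: "0 < L" using c by (simp add: L_def)
  have "(1 - \<alpha>) * (peak + (real (card R) - 1) * base)
      = (1 - \<alpha>)\<^sup>2 * (real (card R) * real (card S) + F) / L"
    unfolding peak_def base_def L_def[symmetric] using L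
    by (simp add: divide_simps power2_eq_square) (simp add: algebra_simps)
  also have "\<dots> = c - \<alpha> * real (card R)"
    unfolding F_eq[symmetric] L_def[symmetric] using L by simp
  finally show ?thesis
    using v by (simp add: row_def succs_S vec_val_S sum.distrib sum_distrib_left[symmetric]
        sum_vec_val_R)
qed

lemma row_R: "v \<in> R \<Longrightarrow> v \<noteq> u0 \<Longrightarrow> row v = c * vec_val v"
proof -
  assume v: "v \<in> R" "v \<noteq> u0"
  have "row v = (\<Sum>w\<in>S. \<alpha> * base + (1 - \<alpha>))"
    unfolding row_def using v by (simp add: succs_R vec_val_R vec_val_S)
  also have "\<dots> = real (card S) * (\<alpha> * base + (1 - \<alpha>))" by simp
  also have "\<dots> = c * base"
    unfolding base_def using c by (simp add: field_simps)
  finally show ?thesis using v by (simp add: vec_val_R)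
qed

text \<open>The defect at the start of the path is a positive multiple of the difference of the two
  sides of \<open>F_le\<close>.\<close>

lemma row_u0:
  "row u0 - c * vec_val u0 = (1 - \<alpha>) * (\<alpha> * real (card S) + t ^ k * (c - \<alpha> * real (card S))
     - F * (c - \<alpha> * real (card S) - \<alpha>)) / (c - \<alpha> * real (card S))"
proof -
  define L where "L = c - \<alpha> * real (card S)"
  have L: "0 < L" using c by (simp add: L_def)
  have "row u0 = \<alpha> * peak + (1 - \<alpha>) * vec_val (ws ! 0) + (\<Sum>w\<in>S. \<alpha> * peak + (1 - \<alpha>))"
    unfolding row_def succs_u0 vec_val_u0
    using ws_notin[of 0] ws_ne by (simp add: vec_val_S algebra_simps)
  also have "vec_val (ws ! 0) = t ^ k" using vec_val_ws[of 0] ws_ne by simp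
  finally have "row u0 - c * vec_val u0
      = (1 - \<alpha>) * (t ^ k + real (card S)) - (L - \<alpha>) * peak"
    by (simp add: L_def vec_val_u0 algebra_simps)
  also have "\<dots> = (1 - \<alpha>) * (\<alpha> * real (card S) + t ^ k * L - F * (L - \<alpha>)) / L"
    unfolding peak_def L_def[symmetric] using L
    by (simp add: divide_simps) (simp add: algebra_simps)
  finally show ?thesis by (simp add: L_def)
qed

lemma row_u0_ge: "c * vec_val u0 \<le> row u0"
proof -
  have "0 \<le> row u0 - c * vec_val u0"
    unfolding row_u0 using F_le alpha c by (intro divide_nonneg_pos mult_nonneg_nonneg) auto
  then show ?thesis by simp
qed

lemma row_u0_eq_iff: "row u0 = c * vec_val u0 \<longleftrightarrow>
    F * (c - \<alpha> * real (card S) - \<alpha>) = \<alpha> * real (card S) + t ^ k * (c - \<alpha> * real (card S))"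
proof -
  have "row u0 = c * vec_val u0 \<longleftrightarrow> row u0 - c * vec_val u0 = 0" by simp
  then show ?thesis unfolding row_u0 using alpha c by auto
qed

text \<open>Since \<open>(c - \<alpha>) * t = 1 - \<alpha>\<close>, consecutive powers of
  \<open>t\<close> satisfy the row equation exactly; only the last row, which sees
  \<open>u1\<close>, can have a defect.\<close>

lemma row_ws:
  assumes i: "i < length ws"
  shows "row (ws ! i) - c * vec_val (ws ! i)
    = (if Suc i = length ws then (1 - \<alpha>) * (vec_val u1 - t ^ (k - length ws)) else 0)"
proof -
  have "k - i = Suc (k - Suc i)" using i length_ws by simp
  then have "(c - \<alpha>) * vec_val (ws ! i) = ((c - \<alpha>) * t) * t ^ (k - Suc i)"
    using vec_val_ws[OF i] by simp
  also have "(c - \<alpha>) * t = 1 - \<alpha>" using c by (simp add: t_def)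
  finally have "(c - \<alpha>) * vec_val (ws ! i) = (1 - \<alpha>) * t ^ (k - Suc i)" .
  moreover have "row (ws ! i) = \<alpha> * vec_val (ws ! i) + (1 - \<alpha>) * vec_val ((ws @ [u1]) ! Suc i)"
    unfolding row_def succs_ws[OF i] by simp
  moreover have "vec_val ((ws @ [u1]) ! Suc i) = (if Suc i = length ws then vec_val u1 else t ^ (k - Suc i))"
    using i vec_val_ws[of "Suc i"] by (auto simp: nth_append)
  ultimately show ?thesis by (auto simp: algebra_simps)
qed

lemma row_ge:
  assumes v: "v \<in> R \<union> S \<union> set ws"
  shows "c * vec_val v \<le> row v"
  using v
proof (cases rule: vertex_cases)
  case (path i)
  have "0 \<le> row (ws ! i) - c * vec_val (ws ! i)"
    unfolding row_ws[OF path(1)] using u1_le_vec_val alpha by simp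
  then show ?thesis using path by simp
qed (use row_S row_R row_u0_ge in auto)

lemma row_eq:
  assumes "F * (c - \<alpha> * real (card S) - \<alpha>) = \<alpha> * real (card S) + t ^ k * (c - \<alpha> * real (card S))"
    and k: "length ws = k" and v: "v \<in> R \<union> S \<union> set ws"
  shows "row v = c * vec_val v"
  using v
proof (cases rule: vertex_cases)
  case (path i)
  \<comment> \<open>An ear of full length cannot return to \<open>R\<close>, so the entry at
    \<open>u1\<close> is 1, the value \<open>t ^ 0\<close> that makes the last row an
    equality.\<close>
  have "u1 \<in> S" using length_ws(2) k u1 by auto
  then have "row (ws ! i) - c * vec_val (ws ! i) = 0"
    unfolding row_ws[OF path(1)] using k by (simp add: vec_val_S)
  then show ?thesis using path by simp
qed (use assms row_S row_R row_u0_eq_iff in auto)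

section \<open>Strongly connected digraphs containing the ear\<close>

context
  fixes G :: "('a, 'b) pre_digraph"
  assumes G: "digraph G" "strongly_connected G"
    and verts_G: "R \<union> S \<union> set ws \<subseteq> verts G" and arcs_G: "ear_arcs \<subseteq> arcs_ends G"
begin

interpretation digraph G by (rule G)

lemma succs_subset_out_nbrs: "succs v \<subseteq> out_nbrs G v"
  using arcs_G by (auto simp: succs_def out_nbrs_def)

lemma A_alpha_op_ear:
  "A_alpha_op \<alpha> G vec_val v
    = row v + (\<Sum>w\<in>out_nbrs G v - succs v. \<alpha> * vec_val v + (1 - \<alpha>) * vec_val w)"
  unfolding A_alpha_op_def row_def
  by (subst sum.subset_diff[OF succs_subset_out_nbrs finite_out_nbrs]) (rule add.commute)

lemma extra_nonneg: "0 \<le> \<alpha> * vec_val v + (1 - \<alpha>) * vec_val w"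
  using vec_val_nonneg alpha by simp

lemma ear_subinvariant: "c * vec_val v \<le> A_alpha_op \<alpha> G vec_val v"
proof (cases "v \<in> R \<union> S \<union> set ws")
  case True
  have "0 \<le> (\<Sum>w\<in>out_nbrs G v - succs v. \<alpha> * vec_val v + (1 - \<alpha>) * vec_val w)"
    by (intro sum_nonneg extra_nonneg)
  then show ?thesis using row_ge[OF True] by (simp add: A_alpha_op_ear)
next
  case False
  then have "vec_val v = 0" using vec_val_pos_iff vec_val_nonneg by (metis less_eq_real_def)
  moreover have "0 \<le> A_alpha_op \<alpha> G vec_val v"
    unfolding A_alpha_op_def by (intro sum_nonneg extra_nonneg)
  ultimately show ?thesis by simp
qed

lemma lambda_alpha_ge_ear: "c \<le> lambda_alpha \<alpha> G"
  using lambda_alpha_ge_subinvariant[of \<alpha> vec_val u0 c] alpha vec_val_nonneg ear_subinvariant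
    vec_val_pos_iff u0 verts_G by auto

text \<open>Equality makes \<open>vec_val\<close> a positive eigenvector, and its support is the
  ear. In each row the ear arcs already account for \<open>c * vec_val v\<close>, whereas any
  further arc would contribute a positive term.\<close>

lemma lambda_alpha_eq_ear:
  assumes eq: "lambda_alpha \<alpha> G = c"
  shows "verts G = R \<union> S \<union> set ws" and "arcs_ends G = ear_arcs"
    and "F * (c - \<alpha> * real (card S) - \<alpha>) = \<alpha> * real (card S) + t ^ k * (c - \<alpha> * real (card S))"
proof -
  have u0_G: "u0 \<in> verts G" "0 < vec_val u0" using u0 verts_G vec_val_pos_iff by auto
  have eig: "A_alpha_op \<alpha> G vec_val v = c * vec_val v" and pos: "0 < vec_val v"
    if "v \<in> verts G" for v
    using lambda_alpha_eq_imp_eigenvector[of \<alpha> vec_val u0 v] G(2) alpha vec_val_nonneg u0_G that eq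
      ear_subinvariant by auto
  show verts: "verts G = R \<union> S \<union> set ws"
    using pos verts_G vec_val_pos_iff by blast
  have rows: "row v = c * vec_val v \<and> out_nbrs G v = succs v" if v: "v \<in> verts G" for v
  proof -
    let ?X = "out_nbrs G v - succs v"
    let ?g = "\<lambda>w. \<alpha> * vec_val v + (1 - \<alpha>) * vec_val w"
    have "0 \<le> sum ?g ?X" by (intro sum_nonneg extra_nonneg)
    moreover have "c * vec_val v \<le> row v" using row_ge v verts by blast
    moreover have "row v + sum ?g ?X = c * vec_val v"
      using eig[OF v] by (simp add: A_alpha_op_ear)
    ultimately have row: "row v = c * vec_val v" and sum0: "sum ?g ?X = 0" by auto
    have "?X = {}"
    proof (rule ccontr)
      assume "?X \<noteq> {}"
      then have "0 < sum ?g ?X"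
        using pos out_nbrs_subset vec_val_nonneg alpha
        by (intro sum_pos add_nonneg_pos mult_pos_pos mult_nonneg_nonneg) auto
      then show False using sum0 by simp
    qed
    then show ?thesis using row succs_subset_out_nbrs by blast
  qed
  show "F * (c - \<alpha> * real (card S) - \<alpha>) = \<alpha> * real (card S) + t ^ k * (c - \<alpha> * real (card S))"
    using rows[OF u0_G(1)] row_u0_eq_iff by blast
  have "arcs_ends G \<subseteq> ear_arcs"
  proof
    fix e assume e: "e \<in> arcs_ends G"
    obtain v w where vw: "e = (v, w)" by fastforce
    then have "v \<in> verts G" using e adj_in_verts by blast
    moreover have "w \<in> out_nbrs G v" using e vw by (simp add: out_nbrs_def)
    ultimately have "w \<in> succs v" using rows by blast
    then show "e \<in> ear_arcs" using vw by (simp add: succs_def)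
  qed
  then show "arcs_ends G = ear_arcs" using arcs_G by blast
qed

end

lemma lambda_alpha_exact_ear:
  fixes G :: "('a, 'b) pre_digraph"
  assumes G: "digraph G" and verts: "verts G = R \<union> S \<union> set ws" and arcs: "arcs_ends G = ear_arcs"
    and k: "length ws = k"
    and F: "F * (c - \<alpha> * real (card S) - \<alpha>) = \<alpha> * real (card S) + t ^ k * (c - \<alpha> * real (card S))"
  shows "lambda_alpha \<alpha> G = c"
proof -
  interpret digraph G by (rule G)
  have "out_nbrs G v = succs v" for v by (simp add: out_nbrs_def succs_def arcs)
  then have "A_alpha_op \<alpha> G vec_val v = row v" for v by (simp add: A_alpha_op_def row_def)
  then show ?thesis
    using lambda_alpha_eq_positive_eigenvector[of \<alpha> vec_val c] alpha row_eq[OF F k] vec_val_pos_iff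
      verts u0 by auto
qed

end

section \<open>Extremal digraphs\<close>

lemma bij_betw_pointed:
  assumes "finite A" "finite B" "card A = card B" "a \<in> A" "b \<in> B"
  obtains f where "bij_betw f A B" "f a = b"
proof -
  have "card (A - {a}) = card (B - {b})" using assms by simp
  then obtain g where g: "bij_betw g (A - {a}) (B - {b})"
    using assms finite_same_card_bij[of "A - {a}" "B - {b}"] by auto
  have "bij_betw (g(a := b)) (A - {a} \<union> {a}) (B - {b} \<union> {b})"
  proof (rule bij_betw_combine)
    show "bij_betw (g(a := b)) (A - {a}) (B - {b})"
      using g by (subst bij_betw_cong[of _ _ g]) auto
  qed auto
  then show ?thesis using assms that[of "g(a := b)"] by (simp add: insert_absorb)
qed

text \<open>The arcs of the target are pairs of vertices, so the vertex map determines the arc map;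
  it is injective because \<open>G\<close> has no parallel arcs.\<close>

lemma digraph_iso_with_projI:
  assumes G: "nomulti_digraph G" and bij: "bij_betw f (verts G) (pverts H)"
    and arcs: "parcs H = map_prod f f ` arcs_ends G"
  shows "digraph_iso G (with_proj H)"
proof -
  interpret nomulti_digraph G by (rule G)
  let ?h = "\<lparr> iso_verts = f, iso_arcs = map_prod f f \<circ> arc_to_ends G, iso_head = snd, iso_tail = fst \<rparr>"
  have inj: "inj_on f (verts G)" using bij by (simp add: bij_betw_def)
  have "inj_on (map_prod f f \<circ> arc_to_ends G) (arcs G)"
  proof (rule inj_onI)
    fix e e' assume e: "e \<in> arcs G" "e' \<in> arcs G"
      and "(map_prod f f \<circ> arc_to_ends G) e = (map_prod f f \<circ> arc_to_ends G) e'"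
    then have "f (tail G e) = f (tail G e')" "f (head G e) = f (head G e')"
      by (auto simp: arc_to_ends_def)
    then have "tail G e = tail G e'" "head G e = head G e'"
      using inj_onD[OF inj] e by auto
    then show "e = e'" using e by (intro no_multi_arcs) (auto simp: arc_to_ends_def)
  qed
  then have "digraph_isomorphism ?h"
    using inj wf_digraph by (simp add: digraph_isomorphism_def arc_to_ends_def)
  moreover have "with_proj H = app_iso ?h G"
    using bij arcs
    by (simp add: with_proj_def app_iso_def arcs_ends_def image_comp bij_betw_def)
  ultimately show ?thesis unfolding digraph_iso_def by blast
qed

lemma (in bip_ear) ear_digraph:
  assumes verts: "pverts H = R \<union> S \<union> set ws" and arcs: "parcs H = ear_arcs"
  shows "digraph (with_proj H)"
proof -
  have vs: "v \<in> pverts H \<and> w \<in> pverts H \<and> v \<noteq> w" if "(v, w) \<in> parcs H" for v w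
  proof -
    have "(v, w) \<in> R \<times> S \<union> S \<times> R \<or> v = u0 \<and> w = ws ! 0
        \<or> (\<exists>i<length ws. v = ws ! i \<and> w = (ws @ [u1]) ! Suc i)"
      using that arcs by (auto simp: ear_arcs_def path_arcs)
    then show ?thesis
    proof (elim disjE exE conjE)
      assume "(v, w) \<in> R \<times> S \<union> S \<times> R"
      then show ?thesis using disj verts by auto
    next
      assume "v = u0" "w = ws ! 0"
      moreover have "w \<in> set ws" using ws_ne \<open>w = ws ! 0\<close> by simp
      ultimately show ?thesis using u0 ws_new verts by blast
    next
      fix i assume i: "i < length ws" "v = ws ! i" "w = (ws @ [u1]) ! Suc i"
      show ?thesis
      proof (cases "Suc i = length ws")
        case True
        then show ?thesis using i u1 verts ws_notin[of i] by auto
      next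
        case False
        then have "Suc i < length ws" using i by simp
        then show ?thesis using i verts ws_index[of i "Suc i"] by (simp add: nth_append)
      qed
    qed
  qed
  have "finite (parcs H)" "finite (pverts H)" by (simp_all add: verts arcs ear_arcs_def)
  then show ?thesis
    by unfold_locales (auto simp: arc_to_ends_def dest: vs)
qed

text \<open>As the ears end on the side opposite to their start, \<open>u0\<close> and
  \<open>u1\<close> can be matched by independent bijections of the two sides; the path vertices are
  matched by position.\<close>

lemma bip_ear_iso:
  fixes G :: "('a, 'b) pre_digraph" and H :: "'c pair_pre_digraph"
  assumes G: "digraph G" "verts G = R \<union> S \<union> set ws" "arcs_ends G = bip_ear.ear_arcs R S u0 ws u1"
    and H: "pverts H = R' \<union> S' \<union> set ws'" "parcs H = bip_ear.ear_arcs R' S' u0' ws' u1'"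
    and ear: "bip_ear R S u0 ws u1" "bip_ear R' S' u0' ws' u1'"
    and u1: "u1 \<in> S" "u1' \<in> S'"
    and card: "card R = card R'" "card S = card S'" "length ws = length ws'"
  shows "digraph_iso G (with_proj H)"
proof -
  interpret E: bip_ear R S u0 ws u1 by (rule ear)
  interpret E': bip_ear R' S' u0' ws' u1' by (rule ear)
  obtain f where f: "bij_betw f R R'" "f u0 = u0'"
    using bij_betw_pointed[of R R' u0 u0'] card E.u0 E'.u0 by auto
  obtain g where g: "bij_betw g S S'" "g u1 = u1'"
    using bij_betw_pointed[of S S' u1 u1'] card u1 by auto
  define h where "h v = the (map_of (zip ws ws') v)" for v
  have map_h: "map h ws = ws'"
    using card(3) E.ws_distinct by (intro nth_equalityI) (auto simp: h_def map_of_zip_nth)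
  have h: "bij_betw h (set ws) (set ws')"
    unfolding bij_betw_def
  proof
    have "distinct (map h ws)" unfolding map_h by (rule E'.ws_distinct)
    then show "inj_on h (set ws)" by (simp add: distinct_map)
    show "h ` set ws = set ws'" using map_h by (metis set_map)
  qed
  define \<phi> where "\<phi> v = (if v \<in> R then f v else if v \<in> S then g v else h v)" for v
  have R: "bij_betw \<phi> R R'"
    using f by (subst bij_betw_cong[of _ _ f]) (auto simp: \<phi>_def)
  have S: "bij_betw \<phi> S S'"
    using g E.disj by (subst bij_betw_cong[of _ _ g]) (auto simp: \<phi>_def)
  have \<phi>_ws: "\<phi> v = h v" if "v \<in> set ws" for v
    using that E.ws_new by (auto simp: \<phi>_def)
  have W: "bij_betw \<phi> (set ws) (set ws')"
    using h by (subst bij_betw_cong[of _ _ h]) (auto simp: \<phi>_ws)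
  have bij: "bij_betw \<phi> (verts G) (pverts H)"
    unfolding G H using E'.disj E'.ws_new
    by (intro bij_betw_combine R S W) auto
  have map_ws: "map \<phi> ws = ws'"
    using map_h \<phi>_ws by (metis map_cong)
  have ends: "\<phi> u0 = u0'" "\<phi> u1 = u1'"
    using E.u0 u1 E.disj f g by (auto simp: \<phi>_def)
  have img: "\<phi> ` R = R'" "\<phi> ` S = S'" using R S by (auto simp: bij_betw_def)
  have "map_prod \<phi> \<phi> ` set (zip (u0 # ws @ [u1]) (ws @ [u1]))
      = set (zip (map \<phi> (u0 # ws @ [u1])) (map \<phi> (ws @ [u1])))"
    by (simp only: zip_map_map set_map map_prod_def)
  also have "\<dots> = set (zip (u0' # ws' @ [u1']) (ws' @ [u1']))"
    using map_ws ends by simp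
  finally have "parcs H = map_prod \<phi> \<phi> ` arcs_ends G"
    unfolding G H E.ear_arcs_def E'.ear_arcs_def image_Un map_prod_surj_on[OF img(1,2)]
    by (simp add: map_prod_surj_on[OF img(1) img(2)] map_prod_surj_on[OF img(2) img(1)])
  then show ?thesis
    using digraph_iso_with_projI[OF _ bij] G(1) by (simp add: digraph_def)
qed

section \<open>Existence of an ear\<close>

lemma successively_alternating_nth:
  fixes P :: "'a \<Rightarrow> bool"
  assumes "successively (\<lambda>x y. P x \<noteq> P y) xs" "i < length xs"
  shows "P (xs ! i) = P (hd xs) \<longleftrightarrow> even i"
  using assms
proof (induction "\<lambda>x y. P x \<noteq> P y" xs arbitrary: i rule: successively.induct)
  case (3 x y xs)
  then show ?case by (cases i) auto
qed auto

text \<open>Strong connectivity gives an arc out of the complete bipartite part and a simple path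
  back. A return to the starting side needs an odd number of new vertices by bipartiteness, while
  \<open>n - p - q\<close> is even.\<close>

lemma bip_class_ear:
  fixes G :: "('a, 'b) pre_digraph" (structure)
  assumes G: "G \<in> bip_class n p q" and pq: "0 < p" "0 < q" and n: "p + q < n" "[n = p + q] (mod 2)"
  obtains R S u0 ws u1 where "bip_ear R S u0 ws u1"
    "card R = p \<and> card S = q \<or> card R = q \<and> card S = p"
    "R \<union> S \<union> set ws \<subseteq> verts G" "bip_ear.ear_arcs R S u0 ws u1 \<subseteq> arcs_ends G"
    "length ws \<le> n - p - q" "u1 \<in> R \<Longrightarrow> length ws < n - p - q"
proof -
  obtain H where dg: "digraph G" and sc: "strongly_connected G" and bip: "bipartite_digraph G"
    and card_G: "card (verts G) = n" and sub: "subgraph H G" and K: "complete_bipartite_digraph p q H"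
    using G unfolding bip_class_def by blast
  interpret digraph G by (rule dg)
  obtain A B where AB: "verts H = A \<union> B" "A \<inter> B = {}" "card A = p" "card B = q"
    "arcs_ends H = A \<times> B \<union> B \<times> A"
    using K unfolding complete_bipartite_digraph_def by blast
  have K_sub: "A \<union> B \<subseteq> verts G" using sub AB by (auto simp: subgraph_def)
  have K_arcs: "A \<times> B \<union> B \<times> A \<subseteq> arcs_ends G" using arcs_ends_mono[OF sub] AB by simp
  have fin: "finite A" "finite B" using K_sub finite_verts by (auto intro: finite_subset)
  have "card (A \<union> B) = p + q" using AB fin by (simp add: card_Un_disjoint)
  then have "A \<union> B \<noteq> verts G" using card_G n by auto
  then obtain w where w: "w \<in> verts G" "w \<notin> A \<union> B" using K_sub by blast
  obtain a where a: "a \<in> A" using AB(3) pq by fastforce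
  have "a \<rightarrow>\<^sup>* w" using sc a K_sub w by blast
  then obtain u0 z where exit: "u0 \<in> A \<union> B" "z \<notin> A \<union> B" "u0 \<rightarrow> z"
    by (rule reachable_crossing_arc[where C = "- (A \<union> B)"]) (use a w in auto)
  have "z \<rightarrow>\<^sup>* a" using sc a K_sub adj_in_verts(2)[OF exit(3)] by blast
  then obtain ws u1 where ws: "ws \<noteq> []" "hd ws = z" "distinct ws" "set ws \<subseteq> verts G - (A \<union> B)"
    "u1 \<in> A \<union> B" "successively (dominates G) (ws @ [u1])"
    using reachable_path_into[of z a "A \<union> B"] exit a by blast
  \<comment> \<open>\<open>R\<close> is whichever side contains the exit vertex \<open>u0\<close>,
    hence the two possible size assignments.\<close>
  obtain R S where RS: "R \<union> S = A \<union> B" "R \<inter> S = {}" "u0 \<in> R" "R \<times> S \<union> S \<times> R = A \<times> B \<union> B \<times> A"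
    and card_RS: "card R = p \<and> card S = q \<or> card R = q \<and> card S = p"
  proof (cases "u0 \<in> A")
    case True
    then show ?thesis using that[of A B] AB by blast
  next
    case False
    then show ?thesis using that[of B A] AB exit by blast
  qed
  have fin_RS: "finite R" "finite S" using RS(1) fin by (metis finite_Un)+
  have ear: "bip_ear R S u0 ws u1"
    by unfold_locales (use RS ws fin_RS in auto)
  interpret bip_ear R S u0 ws u1 by (rule ear)
  have path: "successively (dominates G) (u0 # ws @ [u1])"
    using ws(1,2,6) exit(3) by (simp add: successively_Cons)
  have arcs: "ear_arcs \<subseteq> arcs_ends G"
    using path K_arcs RS(4) unfolding ear_arcs_def successively_conv_zip_tl by auto
  have verts: "R \<union> S \<union> set ws \<subseteq> verts G" using RS(1) K_sub ws(4) by blast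
  have "card (R \<union> S \<union> set ws) \<le> n"
    unfolding card_G[symmetric] using verts by (intro card_mono) auto
  then have len: "length ws \<le> n - p - q"
    using card_vertices card_RS by auto
  have "length ws < n - p - q" if "u1 \<in> R"
  proof -
    obtain U W where UW: "U \<inter> W = {}" "arcs_ends G \<subseteq> U \<times> W \<union> W \<times> U"
      using bip unfolding bipartite_digraph_def by blast
    have flip: "x \<in> U \<longleftrightarrow> y \<notin> U" if "x \<rightarrow> y" for x y using UW that by blast
    \<comment> \<open>A common out-neighbour of \<open>u0\<close> and \<open>u1\<close> shows that
      both lie in the same class of the bipartition of \<open>G\<close>.\<close>
    obtain s where s: "s \<in> S" using card_RS pq by (cases "S = {}") auto
    have "u0 \<rightarrow> s" "u1 \<rightarrow> s" using s that RS(3,4) K_arcs by blast+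
    then have same: "u1 \<in> U \<longleftrightarrow> u0 \<in> U" using flip by blast
    have "successively (\<lambda>x y. (x \<in> U) \<noteq> (y \<in> U)) (u0 # ws @ [u1])"
      using path by (rule successively_mono) (use flip in blast)
    then have "even (Suc (length ws))"
      using successively_alternating_nth[of "\<lambda>x. x \<in> U" "u0 # ws @ [u1]" "Suc (length ws)"] same
      by simp
    moreover have "even (n - p - q)"
      using n by (auto simp: cong_def mod2_eq_if split: if_splits)
    ultimately show ?thesis using len by (cases "length ws = n - p - q") auto
  qed
  then show ?thesis using that[OF ear card_RS verts arcs len] by blast
qed

section \<open>The digraphs \<open>B5\<close> and \<open>B6\<close> as extremal ears\<close>

context
  fixes n p q :: nat
  assumes pq: "0 < p" "0 < q" and n: "p + q < n"
begin

lemma bip_ear_B5: "bip_ear {1..p} {p + 1..p + q} 1 [p + q + 1..<n + 1] (p + 1)"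
  using pq n by unfold_locales auto

text \<open>The path starts on the side of size \<open>q\<close>, so the roles of the two sides are
  exchanged.\<close>

lemma bip_ear_B6: "bip_ear {p + 1..p + q} {1..p} (p + 1) [p + q + 1..<n + 1] 1"
  using pq n by unfold_locales auto

end

lemma lambda_alpha_B5_minimal:
  fixes G :: "('a, 'b) pre_digraph"
  assumes qp: "q \<le> p" and q2: "2 \<le> q" and n: "p + q < n" "[n = p + q] (mod 2)"
    and G: "G \<in> bip_class n p q" and \<alpha>: "0 \<le> \<alpha>" "\<alpha> < 1"
  shows "lambda_alpha \<alpha> (B5 n p q) \<le> lambda_alpha \<alpha> G"
    and "\<alpha> = 0 \<Longrightarrow> lambda_alpha \<alpha> (B6 n p q) = lambda_alpha \<alpha> (B5 n p q)"
    and "lambda_alpha \<alpha> G = lambda_alpha \<alpha> (B5 n p q) \<Longrightarrow>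
      digraph_iso G (B5 n p q) \<or> \<alpha> = 0 \<and> digraph_iso G (B6 n p q)"
proof -
  define k where "k = n - p - q"
  have pq: "0 < p" "0 < q" using qp q2 by auto
  obtain c F t where t: "t = (1 - \<alpha>) / (c - \<alpha>)" "0 < t" "t < 1"
    and c: "\<alpha> < c" "\<alpha> * real p < c" "\<alpha> * real q < c" and F: "0 < F"
    and F_eq: "(c - \<alpha> * real p) * (c - \<alpha> * real q) = (1 - \<alpha>)\<^sup>2 * (real p * real q + F)"
    and F_q: "F * (c - \<alpha> * real q - \<alpha>) = \<alpha> * real q + t ^ k * (c - \<alpha> * real q)"
    by (rule ear_equation_solvable[OF \<alpha> q2 qp])
  \<comment> \<open>Exchanging \<open>p\<close> and \<open>q\<close> in the equation for
    \<open>F\<close> leaves this defect. It is nonnegative, and it vanishes only for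
    \<open>\<alpha> = 0\<close> or \<open>p = q\<close>, which separates \<open>B6\<close> from
    \<open>B5\<close>.\<close>
  have diff: "\<alpha> * real p + t ^ k * (c - \<alpha> * real p) - F * (c - \<alpha> * real p - \<alpha>)
      = \<alpha> * (real p - real q) * (1 - t ^ k + F)"
    using F_q by (simp add: algebra_simps)
  have "t ^ k \<le> 1" using t by (intro power_le_one) auto
  then have pos: "0 < 1 - t ^ k + F" using F by simp
  have "0 \<le> \<alpha> * (real p - real q) * (1 - t ^ k + F)"
    using \<alpha> qp pos by (intro mult_nonneg_nonneg) auto
  then have F_p: "F * (c - \<alpha> * real p - \<alpha>) \<le> \<alpha> * real p + t ^ k * (c - \<alpha> * real p)"
    using diff by linarith
  have F_p_eq: "F * (c - \<alpha> * real p - \<alpha>) = \<alpha> * real p + t ^ k * (c - \<alpha> * real p) \<longleftrightarrow> \<alpha> = 0 \<or> p = q"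
  proof -
    have "F * (c - \<alpha> * real p - \<alpha>) = \<alpha> * real p + t ^ k * (c - \<alpha> * real p)
      \<longleftrightarrow> \<alpha> * (real p - real q) * (1 - t ^ k + F) = 0"
      unfolding diff[symmetric] by auto
    then show ?thesis using pos by auto
  qed
  have ear_vectorI: "ear_vector R S u0 ws u1 \<alpha> c F t k"
    if "bip_ear R S u0 ws u1" "card R = p \<and> card S = q \<or> card R = q \<and> card S = p"
      "length ws \<le> k" "u1 \<in> R \<Longrightarrow> length ws < k" for R S and u0 :: 'x and ws u1
  proof -
    interpret bip_ear R S u0 ws u1 by (rule that)
    have "(c - \<alpha> * real q) * (c - \<alpha> * real p) = (1 - \<alpha>)\<^sup>2 * (real q * real p + F)"
      using F_eq by (simp add: mult.commute)
    then show ?thesis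
      using that(2-) \<alpha> t c F F_eq F_q F_p pq by unfold_locales auto
  qed
  let ?P = "{1..p}" and ?Q = "{p + 1..p + q}" and ?ws = "[p + q + 1..<n + 1]"
  note B5 = bip_ear_B5[OF pq n(1)] and B6 = bip_ear_B6[OF pq n(1)]
  have len: "length ?ws = k" using n by (simp add: k_def)
  have verts_B: "pverts (add_dipath (K_bip p q) ([x] @ ?ws @ [y])) = ?P \<union> ?Q \<union> set ?ws"
    if "x \<in> ?P \<union> ?Q" "y \<in> ?P \<union> ?Q" for x y
    using that by (auto simp: add_dipath_def K_bip_def Let_def)
  have verts_B5: "pverts (add_dipath (K_bip p q) ([1] @ ?ws @ [p + 1])) = ?P \<union> ?Q \<union> set ?ws"
    and verts_B6: "pverts (add_dipath (K_bip p q) ([p + 1] @ ?ws @ [1])) = ?Q \<union> ?P \<union> set ?ws"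
    using verts_B[of 1 "p + 1"] verts_B[of "p + 1" 1] pq by auto
  have arcs_B5: "parcs (add_dipath (K_bip p q) ([1] @ ?ws @ [p + 1])) = bip_ear.ear_arcs ?P ?Q 1 ?ws (p + 1)"
    unfolding bip_ear.ear_arcs_def[OF B5] by (simp add: add_dipath_def K_bip_def Let_def)
  have arcs_B6: "parcs (add_dipath (K_bip p q) ([p + 1] @ ?ws @ [1])) = bip_ear.ear_arcs ?Q ?P (p + 1) ?ws 1"
    unfolding bip_ear.ear_arcs_def[OF B6] by (simp add: add_dipath_def K_bip_def Let_def Un_commute)
  have lam5: "lambda_alpha \<alpha> (B5 n p q) = c"
  proof -
    interpret ear_vector ?P ?Q 1 ?ws "p + 1" \<alpha> c F t k
      by (rule ear_vectorI[OF B5]) (use len pq in auto)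
    show ?thesis
      unfolding B5_def
      by (rule lambda_alpha_exact_ear[OF ear_digraph[OF verts_B5 arcs_B5] _ _ len])
        (use verts_B5 arcs_B5 F_q in auto)
  qed
  show "lambda_alpha \<alpha> (B6 n p q) = lambda_alpha \<alpha> (B5 n p q)" if "\<alpha> = 0"
  proof -
    interpret ear_vector ?Q ?P "p + 1" ?ws 1 \<alpha> c F t k
      by (rule ear_vectorI[OF B6]) (use len pq in auto)
    show ?thesis
      unfolding lam5 unfolding B6_def
      by (rule lambda_alpha_exact_ear[OF ear_digraph[OF verts_B6 arcs_B6] _ _ len])
        (use verts_B6 arcs_B6 F_p_eq that in auto)
  qed
  have dg: "digraph G" and sc: "strongly_connected G" and card_G: "card (verts G) = n"
    using G by (auto simp: bip_class_def)
  obtain R S u0 ws u1 where ear: "bip_ear R S u0 ws u1"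
    and card_RS: "card R = p \<and> card S = q \<or> card R = q \<and> card S = p"
    and sub: "R \<union> S \<union> set ws \<subseteq> verts G" "bip_ear.ear_arcs R S u0 ws u1 \<subseteq> arcs_ends G"
    and len_ws: "length ws \<le> k" "u1 \<in> R \<Longrightarrow> length ws < k"
    using bip_class_ear[OF G pq n] unfolding k_def by metis
  interpret ear_vector R S u0 ws u1 \<alpha> c F t k
    by (rule ear_vectorI[OF ear card_RS len_ws])
  show "lambda_alpha \<alpha> (B5 n p q) \<le> lambda_alpha \<alpha> G"
    unfolding lam5 by (rule lambda_alpha_ge_ear[OF dg sc sub])
  assume "lambda_alpha \<alpha> G = lambda_alpha \<alpha> (B5 n p q)"
  then have "lambda_alpha \<alpha> G = c" by (simp add: lam5)
  note eq = lambda_alpha_eq_ear[OF dg sc sub this]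
  \<comment> \<open>The ear now covers all \<open>n\<close> vertices, so it has full length and must
    end in \<open>S\<close>.\<close>
  have len_eq: "length ws = k"
    using card_G card_vertices card_RS n unfolding eq(1) k_def by auto
  then have u1: "u1 \<in> S" using len_ws(2) u1 by auto
  show "digraph_iso G (B5 n p q) \<or> \<alpha> = 0 \<and> digraph_iso G (B6 n p q)"
  proof (cases "card R = p \<and> card S = q")
    case True
    have "digraph_iso G (B5 n p q)"
      unfolding B5_def
      by (rule bip_ear_iso[OF dg eq(1,2) verts_B5 arcs_B5 ear B5 u1])
        (use True pq len len_eq in auto)
    then show ?thesis ..
  next
    \<comment> \<open>The case \<open>p = q\<close> belongs to the previous branch, so here the
      sizes differ and the equation at \<open>u0\<close> forces \<open>\<alpha> = 0\<close>.\<close>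
    case False
    then have *: "card R = q" "card S = p" "p \<noteq> q" using card_RS by auto
    then have "\<alpha> = 0" using eq(3) F_p_eq by simp
    moreover have "digraph_iso G (B6 n p q)"
      unfolding B6_def
      by (rule bip_ear_iso[OF dg eq(1,2) verts_B6 arcs_B6 ear B6 u1])
        (use * pq len len_eq in auto)
    ultimately show ?thesis by blast
  qed
qed

theorem theorem4p9:
  fixes G :: "('a, 'b) pre_digraph" and n p q :: nat
  assumes "p \<ge> q" and "q \<ge> 2"
    and "p + q \<le> n - 1" and "[n = p + q] (mod 2)"
    and "G \<in> bip_class n p q"
  shows "(\<forall>\<alpha>::real. \<alpha> = 0 \<longrightarrow>
            lambda_alpha \<alpha> G \<ge> lambda_alpha \<alpha> (B5 n p q)
          \<and> lambda_alpha \<alpha> (B5 n p q) = lambda_alpha \<alpha> (B6 n p q)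
          \<and> (lambda_alpha \<alpha> G = lambda_alpha \<alpha> (B5 n p q)
               \<longleftrightarrow> digraph_iso G (B5 n p q) \<or> digraph_iso G (B6 n p q)))
       \<and> (\<forall>\<alpha>::real. 0 < \<alpha> \<and> \<alpha> < 1 \<longrightarrow>
            lambda_alpha \<alpha> G \<ge> lambda_alpha \<alpha> (B5 n p q)
          \<and> (lambda_alpha \<alpha> G = lambda_alpha \<alpha> (B5 n p q)
               \<longleftrightarrow> digraph_iso G (B5 n p q)))"
proof -
  \<comment> \<open>The subtraction is truncated; \<open>q \<ge> 2\<close> excludes
    \<open>n = 0\<close>.\<close>
  have n: "p + q < n" using assms by linarith
  note minimal = lambda_alpha_B5_minimal[OF assms(1,2) n assms(4,5)]
  interpret digraph G using assms(5) by (simp add: bip_class_def)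
  have iso: "lambda_alpha \<alpha> G = lambda_alpha \<alpha> H" if "digraph_iso G H"
    for \<alpha> and H :: "(nat, nat \<times> nat) pre_digraph"
    using lambda_alpha_iso[OF finite_verts that] .
  show ?thesis
  proof (intro conjI allI impI)
    fix \<alpha> :: real assume "\<alpha> = 0"
    then have \<alpha>: "0 \<le> \<alpha>" "\<alpha> < 1" by auto
    note min = minimal[OF \<alpha>]
    show "lambda_alpha \<alpha> (B5 n p q) \<le> lambda_alpha \<alpha> G" by (rule min(1))
    show 56: "lambda_alpha \<alpha> (B5 n p q) = lambda_alpha \<alpha> (B6 n p q)"
      using min(2) \<open>\<alpha> = 0\<close> by simp
    show "lambda_alpha \<alpha> G = lambda_alpha \<alpha> (B5 n p q)
        \<longleftrightarrow> digraph_iso G (B5 n p q) \<or> digraph_iso G (B6 n p q)"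
      using min(3) iso 56 by metis
  next
    fix \<alpha> :: real assume "0 < \<alpha> \<and> \<alpha> < 1"
    then have \<alpha>: "0 \<le> \<alpha>" "\<alpha> < 1" "\<alpha> \<noteq> 0" by auto
    note min = minimal[OF \<alpha>(1,2)]
    show "lambda_alpha \<alpha> (B5 n p q) \<le> lambda_alpha \<alpha> G" by (rule min(1))
    show "lambda_alpha \<alpha> G = lambda_alpha \<alpha> (B5 n p q) \<longleftrightarrow> digraph_iso G (B5 n p q)"
      using min(3) iso \<alpha>(3) by blast
  qed
qed

end
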